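(* Let $0<s<\frac12$ and $\Lambda\in\mathbb{N}$. Then, for every $X\in\mathcal{R}^\Lambda$ with $\mathcal{S}(X)\subset(0,\Lambda)$ and for every $h\in\mathbb{R}^\Lambda$, $$\langle\nabla^2\mathcal{E}^s(X)h,h\rangle=\sum_{\{\xi,\eta\}\subset\mathcal{S}(X),\ \xi\neq\eta}a^s(\xi,\eta)\,(h_{\lambda(\xi)}-h_{\lambda(\eta)})^2,$$ where the sum runs over unordered pairs and $$a^s(\xi,\eta):=2\sum_{z\in\mathbb{Z}}\frac{1}{|\xi-\eta+\Lambda z|^{1+2s}}\qquad\text{for every }\xi,\eta\in\mathcal{S}(X)\text{ with }\xi\ne\eta .$$ As a consequence, if $\sum_{\lambda=1}^\Lambda h_\lambda=0$, then $$\langle\nabla^2\mathcal{E}^s(X)h,h\rangle\ge\gamma(s)\Lambda^{-2s}|h|^2,$$ for some positive constant $\gamma(s)$ depending only on $s$. Moreover, for every $X\in\mathcal{C}^\Lambda$, there exists $h\in\mathbb{R}^\Lambda$ with $h\neq0$, $\sum_{\lambda=1}^\Lambda h_\lambda=0$ and $$\langle\nabla^2\mathcal{E}^s(X)h,h\rangle\le\Gamma(s)\Lambda^{-2s}|h|^2,$$ for some positive constant $\Gamma(s)$ depending only on $s$.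
   Context: Let $\mathcal{X}^\Lambda:=[0,\Lambda)^\Lambda$; entries of $X=(x_1,\dots,x_\Lambda)\in\mathcal{X}^\Lambda$ need not be distinct. Let $\mathcal{S}(X):=\{x_1,\dots,x_\Lambda\}$, and let $\mathcal{R}^\Lambda$ be the set of $X\in\mathcal{X}^\Lambda$ with pairwise distinct entries; for $X\in\mathcal{R}^\Lambda$ and $\xi\in\mathcal{S}(X)$, $\lambda(\xi)$ is the unique index $\lambda$ with $x_\lambda=\xi$. Let $\mathcal{C}^\Lambda:=\{X\in\mathcal{R}^\Lambda:\ \mathcal{S}(X)=\{\tau,1+\tau,\dots,\Lambda-1+\tau\}\text{ for some }\tau\in[0,1)\}$. Let $\mu^X:=\sum_{\lambda=1}^{\Lambda}\sum_{k\in\mathbb{Z}}\delta_{x_\lambda+\Lambda k}$, and let $u^X\in BV_{\rm loc}(\mathbb{R})$ be the function, unique up to additive constants and $\Lambda$-periodic, whose distributional derivative is $(u^X)'=\mathrm{d}x-\mu^X$. For $0<s<\frac12$, $$\mathcal{E}^s(X):=\frac12\int_0^\Lambda \mathrm{d}x\int_{\mathbb{R}}\frac{|u^X(x)-u^X(y)|^2}{|x-y|^{1+2s}}\,\mathrm{d}y .$$ The Hessian $\nabla^2\mathcal{E}^s$ is taken with respect to $(x_1,\dots,x_\Lambda)$, positions being read modulo $\Lambda$ (the energy depends on $X$ only through $\mu^X$).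
   Formalization: The last claim, on crystals X in C^Λ, is stated for Λ ≥ 2 only: for Λ = 1 the condition that the entries of h sum to zero forces h = 0, so no nonzero h exists. *)

theory Defs
  imports "HOL-Analysis.Analysis"
begin

section \<open>Configurations\<close>

text \<open>
  A vector of \<open>\<real>\<^sup>\<Lambda>\<close> is a function \<open>nat \<Rightarrow> real\<close> of which only the values at the indices
  \<open>1, \<dots>, \<Lambda>\<close> matter; the dimension \<open>\<Lambda>\<close> has to be a term, because the constants in the
  theorem must not depend on it.
\<close>

definition configs :: "nat \<Rightarrow> (nat \<Rightarrow> real) set"
  where "configs \<Lambda> = {1..\<Lambda>} \<rightarrow>\<^sub>E {0..<real \<Lambda>}"

definition supp :: "nat \<Rightarrow> (nat \<Rightarrow> real) \<Rightarrow> real set"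
  where "supp \<Lambda> X = X ` {1..\<Lambda>}"

definition regular_configs :: "nat \<Rightarrow> (nat \<Rightarrow> real) set"
  where "regular_configs \<Lambda> = {X \<in> configs \<Lambda>. inj_on X {1..\<Lambda>}}"

definition crystals :: "nat \<Rightarrow> (nat \<Rightarrow> real) set"
  where "crystals \<Lambda> =
    {X \<in> regular_configs \<Lambda>. \<exists>\<tau>\<in>{0..<1}. supp \<Lambda> X = (\<lambda>j. real j + \<tau>) ` {..<\<Lambda>}}"

definition index_of :: "nat \<Rightarrow> (nat \<Rightarrow> real) \<Rightarrow> real \<Rightarrow> nat"
  where "index_of \<Lambda> X \<xi> = (THE l. l \<in> {1..\<Lambda>} \<and> X l = \<xi>)"

section \<open>The energy\<close>

text \<open>
  The sum of Dirac masses \<open>\<Sum>\<^sub>\<lambda> \<Sum>\<^sub>k \<delta>(x\<^sub>\<lambda> + \<Lambda>k)\<close>, counted with multiplicity, as the image of a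
  counting measure.  Like everything below it makes sense for arbitrary \<open>X\<close> in \<open>\<real>\<^sup>\<Lambda>\<close> and is
  unchanged when an entry is shifted by a multiple of \<open>\<Lambda>\<close>; this is how positions
  are read modulo \<open>\<Lambda>\<close>.
\<close>

definition dislocation_measure :: "nat \<Rightarrow> (nat \<Rightarrow> real) \<Rightarrow> real measure"
  where "dislocation_measure \<Lambda> X =
    distr (count_space ({1..\<Lambda>} \<times> (UNIV :: int set))) borel
      (\<lambda>(l, k). X l + real \<Lambda> * real_of_int k)"

definition test_function :: "(real \<Rightarrow> real) \<Rightarrow> bool"
  where "test_function \<phi> \<longleftrightarrow>
    (\<forall>n x. (deriv ^^ n) \<phi> differentiable (at x)) \<and> compact (closure {x. \<phi> x \<noteq> 0})"

text \<open>
  \<open>u\<close> is locally integrable with distributional derivative \<open>dx - \<mu>\<^sup>X\<close>.  The latter is a signed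
  Radon measure, so this says precisely that \<open>u\<close> is in \<open>BV\<^sub>l\<^sub>o\<^sub>c\<close> with that derivative.
\<close>

definition is_displacement :: "nat \<Rightarrow> (nat \<Rightarrow> real) \<Rightarrow> (real \<Rightarrow> real) \<Rightarrow> bool"
  where "is_displacement \<Lambda> X u \<longleftrightarrow>
    (\<forall>a b. set_integrable lborel {a..b} u) \<and>
    (\<forall>\<phi>. test_function \<phi> \<longrightarrow>
      (LINT x|lborel. u x * deriv \<phi> x) =
      - ((LINT x|lborel. \<phi> x) - (LINT x|dislocation_measure \<Lambda> X. \<phi> x)))"

text \<open>
  Such a \<open>u\<close> is unique up to an additive constant and a null set, neither of which affects
  the energy.
\<close>

definition displacement :: "nat \<Rightarrow> (nat \<Rightarrow> real) \<Rightarrow> real \<Rightarrow> real"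
  where "displacement \<Lambda> X = (SOME u. is_displacement \<Lambda> X u)"

definition energy :: "real \<Rightarrow> nat \<Rightarrow> (nat \<Rightarrow> real) \<Rightarrow> real"
  where "energy s \<Lambda> X = (let u = displacement \<Lambda> X in
    1 / 2 * enn2real (\<integral>\<^sup>+x\<in>{0..<real \<Lambda>}.
      (\<integral>\<^sup>+y. ennreal (\<bar>u x - u y\<bar>\<^sup>2 / \<bar>x - y\<bar> powr (1 + 2 * s)) \<partial>lborel) \<partial>lborel))"

section \<open>The Hessian\<close>

definition partial_deriv :: "nat \<Rightarrow> ((nat \<Rightarrow> real) \<Rightarrow> real) \<Rightarrow> (nat \<Rightarrow> real) \<Rightarrow> real"
  where "partial_deriv i f x = deriv (\<lambda>t. f (x(i := t))) (x i)"

definition hessian :: "((nat \<Rightarrow> real) \<Rightarrow> real) \<Rightarrow> (nat \<Rightarrow> real) \<Rightarrow> nat \<Rightarrow> nat \<Rightarrow> real"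
  where "hessian f x i j = partial_deriv i (partial_deriv j f) x"

definition hessian_form ::
    "nat \<Rightarrow> ((nat \<Rightarrow> real) \<Rightarrow> real) \<Rightarrow> (nat \<Rightarrow> real) \<Rightarrow> (nat \<Rightarrow> real) \<Rightarrow> real"
  where "hessian_form n f x h =
    (\<Sum>i = 1..n. (\<Sum>j = 1..n. hessian f x i j * h j) * h i)"

text \<open>
  Since \<^const>\<open>deriv\<close> is total, the existence of the Hessian is expressed separately: \<open>f\<close> is twice
  continuously differentiable, in the first \<open>n\<close> variables, on a neighbourhood of \<open>x\<close>.  Open sets
  refer to the product topology on \<open>nat \<Rightarrow> real\<close>; for an \<open>f\<close> that depends only on the
  coordinates \<open>1, \<dots>, n\<close> this is the usual notion on \<open>\<real>\<^sup>n\<close>.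
\<close>

definition C2_near :: "nat \<Rightarrow> ((nat \<Rightarrow> real) \<Rightarrow> real) \<Rightarrow> (nat \<Rightarrow> real) \<Rightarrow> bool"
  where "C2_near n f x \<longleftrightarrow> (\<exists>U. open U \<and> x \<in> U \<and>
    (\<forall>y\<in>U. \<forall>j\<in>{1..n}. (\<lambda>t. f (y(j := t))) differentiable (at (y j))) \<and>
    (\<forall>y\<in>U. \<forall>i\<in>{1..n}. \<forall>j\<in>{1..n}.
      (\<lambda>t. partial_deriv j f (y(i := t))) differentiable (at (y i))) \<and>
    (\<forall>i\<in>{1..n}. \<forall>j\<in>{1..n}. continuous_on U (\<lambda>y. hessian f y i j)))"

definition coupling :: "real \<Rightarrow> nat \<Rightarrow> real \<Rightarrow> real \<Rightarrow> real"
  where "coupling s \<Lambda> \<xi> \<eta> =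
    2 * (\<Sum>\<^sub>\<infinity>z\<in>(UNIV :: int set). 1 / \<bar>\<xi> - \<eta> + real \<Lambda> * real_of_int z\<bar> powr (1 + 2 * s))"

end

theory Submission
  imports Defs "HOL-Real_Asymp.Real_Asymp"
begin

text \<open>
  Up to a constant and a null set, \<open>u\<^sup>X\<close> is the sum of the sawtooths \<open>frac ((x - x\<^sub>\<lambda>) / \<Lambda>)\<close>.
  Substituting \<open>y = x + z\<close> and integrating over \<open>x\<close> first, the energy becomes
  \<open>\<Sum>\<^sub>\<lambda>\<^sub>,\<^sub>\<mu> W (x\<^sub>\<lambda> - x\<^sub>\<mu>)\<close> with \<open>W r = \<integral> (C r - C (r + z)) / |z| powr (1 + 2 * s) dz\<close>, where \<open>C\<close> is the
  autocorrelation of the sawtooth.  Off the lattice \<open>\<Lambda>\<int>\<close>, \<open>C' r = frac (r / \<Lambda>) - 1 / 2\<close> gives \<open>W'\<close>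
  by dominated convergence.  An increment of \<open>W'\<close> is the integral of a difference of floors, that is,
  of a count of lattice points, and Tonelli turns it into the integral of
  \<open>W'' r = \<Sum>\<^sub>k 1 / |r + \<Lambda>k| powr (1 + 2 * s)\<close>.  Hence the Hessian form is
  \<open>\<Sum>\<^sub>\<lambda>\<^sub>,\<^sub>\<mu> W'' (x\<^sub>\<lambda> - x\<^sub>\<mu>) (h\<^sub>\<lambda> - h\<^sub>\<mu>)\<^sup>2\<close>.

  The lower bound follows from \<open>W'' \<ge> \<Lambda> powr (- 1 - 2 * s)\<close>.  For the upper bound, \<open>h\<close> is one of
  \<open>cos (2 \<pi> x\<^sub>\<lambda> / \<Lambda>)\<close> and \<open>sin (2 \<pi> x\<^sub>\<lambda> / \<Lambda>)\<close>: with \<open>m\<close> the distance of \<open>x\<^sub>\<lambda> - x\<^sub>\<mu>\<close> to \<open>\<Lambda>\<int>\<close>, \<open>W''\<close> is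
  of order \<open>m powr (- 1 - 2 * s)\<close> and the squared chord of order \<open>m\<^sup>2 / \<Lambda>\<^sup>2\<close>, and
  \<open>m powr (1 - 2 * s) \<le> \<Lambda> powr (1 - 2 * s)\<close> because \<open>s < 1 / 2\<close>.
\<close>

section \<open>Smooth bump functions\<close>

text \<open>Dividing by \<open>x ^ k\<close> closes the family under differentiation up to linear
  combinations. The case \<open>k = 0\<close> is the standard smooth function that is flat at
  0.\<close>

definition flat_exp :: "nat \<Rightarrow> real \<Rightarrow> real"
  where "flat_exp k x = (if x > 0 then exp (- (1 / x)) / x ^ k else 0)"

lemma flat_exp_tendsto_0: "((\<lambda>x::real. exp (- (1 / x)) / x ^ k) \<longlongrightarrow> 0) (at_right 0)"
  by real_asymp

lemma flat_exp_DERIV: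
  "(flat_exp k has_real_derivative (flat_exp (k + 2) x - real k * flat_exp (k + 1) x)) (at x)"
proof -
  consider "x > 0" | "x < 0" | "x = 0" by linarith
  then show ?thesis
  proof cases
    case 1
    have "((\<lambda>x. exp (- (1 / x)) / x ^ k) has_real_derivative
        (flat_exp (k + 2) x - real k * flat_exp (k + 1) x)) (at x)"
      using 1 by (auto intro!: derivative_eq_intros simp: flat_exp_def field_simps power_add power2_eq_square)
        (cases k; simp add: field_simps)
    then show ?thesis
    proof (rule has_field_derivative_transform_within_open[where S="{0<..}"])
    qed (use 1 in \<open>auto simp: flat_exp_def\<close>)
  next
    case 2
    have "((\<lambda>x. 0) has_real_derivative
        (flat_exp (k + 2) x - real k * flat_exp (k + 1) x)) (at x)"
      using 2 by (auto simp: flat_exp_def)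
    then show ?thesis
    proof (rule has_field_derivative_transform_within_open[where S="{..<0}"])
    qed (use 2 in \<open>auto simp: flat_exp_def\<close>)
  next
    case 3
    have "((\<lambda>y. (flat_exp k y - flat_exp k 0) / (y - 0)) \<longlongrightarrow> 0) (at 0)"
      unfolding filterlim_at_split
    proof
      have "eventually (\<lambda>y::real. (flat_exp k y - flat_exp k 0) / (y - 0) = 0) (at_left 0)"
        unfolding eventually_at_filter by (auto simp: flat_exp_def)
      then show "((\<lambda>y. (flat_exp k y - flat_exp k 0) / (y - 0)) \<longlongrightarrow> 0) (at_left 0)"
        by (rule tendsto_eventually)
      \<comment> \<open>The right difference quotient at 0 is the next member of the family, so one
        limit, known for all \<open>k\<close>, settles every order.\<close>
      have "eventually (\<lambda>y::real. exp (- (1 / y)) / y ^ Suc k = (flat_exp k y - flat_exp k 0) / (y - 0)) (at_right 0)"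
        unfolding eventually_at_filter by (auto simp: flat_exp_def)
      with flat_exp_tendsto_0[of "Suc k"]
      show "((\<lambda>y. (flat_exp k y - flat_exp k 0) / (y - 0)) \<longlongrightarrow> 0) (at_right 0)"
        by (rule Lim_transform_eventually)
    qed
    then show ?thesis
      using 3 by (simp add: has_field_derivative_iff flat_exp_def)
  qed
qed

text \<open>A class of formulas closed under \<open>deriv\<close>: induction then yields
  differentiability of all iterates \<open>(deriv ^^ n) f\<close>, which is what
  \<open>test_function\<close> demands.\<close>

inductive smooth_class :: "(real \<Rightarrow> real) \<Rightarrow> bool" where
  const: "smooth_class (\<lambda>x. c)"
| flat: "smooth_class (\<lambda>x. flat_exp k (a * x + b))"
| add: "smooth_class f \<Longrightarrow> smooth_class g \<Longrightarrow> smooth_class (\<lambda>x. f x + g x)"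
| mult: "smooth_class f \<Longrightarrow> smooth_class g \<Longrightarrow> smooth_class (\<lambda>x. f x * g x)"

lemma smooth_class_DERIV:
  "smooth_class f \<Longrightarrow> \<exists>f'. smooth_class f' \<and> (\<forall>x. (f has_real_derivative f' x) (at x))"
proof (induction rule: smooth_class.induct)
  case (const c)
  show ?case by (intro exI[of _ "\<lambda>x. 0"]) (auto intro: smooth_class.const)
next
  case (flat k a b)
  have "((\<lambda>x. flat_exp k (a * x + b)) has_real_derivative
      (flat_exp (k + 2) (a * x + b) + (- real k) * flat_exp (k + 1) (a * x + b)) * a) (at x)" for x
  proof -
    have "((\<lambda>x. a * x + b) has_real_derivative a) (at x)"
      by (auto intro!: derivative_eq_intros)
    from DERIV_chain2[OF flat_exp_DERIV this] show ?thesis by simp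
  qed
  moreover have "smooth_class
      (\<lambda>x. (flat_exp (k + 2) (a * x + b) + (- real k) * flat_exp (k + 1) (a * x + b)) * a)"
    by (intro smooth_class.intros)
  ultimately show ?case by (intro exI conjI allI)
next
  case (add f g)
  then obtain f' g' where "smooth_class f'" "smooth_class g'"
    "\<forall>x. (f has_real_derivative f' x) (at x)" "\<forall>x. (g has_real_derivative g' x) (at x)" by blast
  then show ?case
    by (intro exI[of _ "\<lambda>x. f' x + g' x"]) (auto intro!: smooth_class.intros derivative_eq_intros)
next
  case (mult f g)
  then obtain f' g' where "smooth_class f'" "smooth_class g'"
    "\<forall>x. (f has_real_derivative f' x) (at x)" "\<forall>x. (g has_real_derivative g' x) (at x)" by blast
  with mult.hyps show ?case
    by (intro exI[of _ "\<lambda>x. f' x * g x + f x * g' x"])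
      (auto intro!: smooth_class.intros derivative_eq_intros)
qed

lemma smooth_class_deriv: "smooth_class f \<Longrightarrow> smooth_class (deriv f)"
proof -
  assume "smooth_class f"
  then obtain f' where f': "smooth_class f'" "\<forall>x. (f has_real_derivative f' x) (at x)"
    using smooth_class_DERIV by blast
  then have "deriv f = f'" by (auto intro: DERIV_imp_deriv)
  with f' show ?thesis by simp
qed

lemma smooth_class_funpow_deriv: "smooth_class f \<Longrightarrow> smooth_class ((deriv ^^ n) f)"
  by (induction n) (auto intro: smooth_class_deriv)

lemma smooth_class_differentiable: "smooth_class f \<Longrightarrow> f differentiable (at x)"
  using smooth_class_DERIV real_differentiable_def by blast

lemma smooth_class_continuous: "smooth_class f \<Longrightarrow> continuous_on S f"
  by (meson smooth_class_differentiable continuous_at_imp_continuous_on differentiable_imp_continuous_within)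

text \<open>The primitive from \<open>p\<close> vanishes beyond \<open>q\<close> because the mean is
  zero. It need not lie in \<open>smooth_class\<close> itself: its derivatives of positive order are
  derivatives of \<open>b\<close>.\<close>

lemma test_function_primitive:
  assumes sm: "smooth_class b" and supp: "\<And>x. x \<notin> {p..q} \<Longrightarrow> b x = 0" and "p \<le> q"
    and z: "integral {p..q} b = 0"
  obtains \<phi> where "test_function \<phi>" "deriv \<phi> = b"
proof -
  define \<phi> where "\<phi> x = (if x \<le> p then 0 else integral {p..x} b)" for x
  have int: "b integrable_on {x..y}" for x y
    by (intro integrable_continuous_interval smooth_class_continuous sm)
  \<comment> \<open>Moving the base point to the left removes the case distinction at
    \<open>p\<close>, so that \<open>\<phi>\<close> can be differentiated there as well.\<close>
  have \<phi>_eq: "\<phi> x = integral {r..x} b" if "r \<le> p" "r \<le> x" for r x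
  proof (cases "x \<le> p")
    case True
    have "integral {r..x} b = integral {r..x} (\<lambda>x. 0)"
    proof (rule integral_spike[of "{p}"])
    qed (use True in \<open>auto intro: supp\<close>)
    then show ?thesis using True by (simp add: \<phi>_def)
  next
    case False
    have "integral {r..p} b = integral {r..p} (\<lambda>x. 0)"
    proof (rule integral_spike[of "{p}"])
    qed (auto intro: supp)
    moreover have "integral {r..x} b = integral {r..p} b + integral {p..x} b"
      using False that int by (intro Henstock_Kurzweil_Integration.integral_combine[symmetric]) auto
    ultimately show ?thesis using False by (simp add: \<phi>_def)
  qed
  have D: "(\<phi> has_real_derivative b x) (at x)" for x
  proof -
    define r where "r = min p x - 1"
    have "((\<lambda>u. integral {r..u} b) has_real_derivative b x) (at x within {r..x + 1})"
      by (rule integral_has_real_derivative) (auto intro: smooth_class_continuous sm simp: r_def)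
    then have "((\<lambda>u. integral {r..u} b) has_real_derivative b x) (at x)"
      by (subst (asm) at_within_interior) (auto simp: r_def)
    then show ?thesis
      by (rule has_field_derivative_transform_within_open[where S="{r<..}"])
        (auto intro!: \<phi>_eq[symmetric] simp: r_def)
  qed
  then have dphi: "deriv \<phi> = b" by (auto intro: DERIV_imp_deriv)
  have "(deriv ^^ n) \<phi> differentiable (at x)" for n x
  proof (cases n)
    case 0
    then show ?thesis using D real_differentiable_def by auto
  next
    case (Suc m)
    then have "(deriv ^^ n) \<phi> = (deriv ^^ m) b"
      by (simp add: funpow_Suc_right dphi del: funpow.simps)
    then show ?thesis
      using smooth_class_differentiable smooth_class_funpow_deriv sm by simp
  qed
  moreover have "{x. \<phi> x \<noteq> 0} \<subseteq> {p..q}"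
  proof
    fix x assume "x \<in> {x. \<phi> x \<noteq> 0}"
    then have x: "\<phi> x \<noteq> 0" by simp
    then have "x > p" by (auto simp: \<phi>_def split: if_splits)
    moreover have "x \<le> q"
    proof (rule ccontr)
      assume "\<not> x \<le> q"
      then have "integral {p..x} b = integral {p..q} b + integral {q..x} b"
        using \<open>p \<le> q\<close> int by (intro Henstock_Kurzweil_Integration.integral_combine[symmetric]) auto
      moreover have "integral {q..x} b = integral {q..x} (\<lambda>x. 0)"
      proof (rule integral_spike[of "{q}"])
      qed (auto intro: supp)
      ultimately show False using x z \<open>x > p\<close> by (simp add: \<phi>_def)
    qed
    ultimately show "x \<in> {p..q}" by simp
  qed
  then have "compact (closure {x. \<phi> x \<noteq> 0})"
    by (meson bounded_closed_interval bounded_subset compact_closure)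
  ultimately have "test_function \<phi>" by (auto simp: test_function_def)
  with dphi show ?thesis using that by blast
qed

text \<open>The factor \<open>Suc n\<close> steepens both flanks: at each point of the open interval
  the values tend to 1 as \<open>n\<close> grows.\<close>

definition bump :: "nat \<Rightarrow> real \<Rightarrow> real \<Rightarrow> real \<Rightarrow> real"
  where "bump n p q x = flat_exp 0 (real (Suc n) * (x - p)) * flat_exp 0 (real (Suc n) * (q - x))"

lemma smooth_class_bump: "smooth_class (bump n p q)"
proof -
  have "smooth_class (\<lambda>x. flat_exp 0 (real (Suc n) * x + (- real (Suc n) * p)) *
      flat_exp 0 (- real (Suc n) * x + real (Suc n) * q))"
    by (intro smooth_class.intros)
  also have "(\<lambda>x. flat_exp 0 (real (Suc n) * x + (- real (Suc n) * p)) *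
      flat_exp 0 (- real (Suc n) * x + real (Suc n) * q)) = bump n p q"
    unfolding bump_def by (intro ext arg_cong2[where f="(*)"] arg_cong[where f="flat_exp 0"])
      (auto simp: algebra_simps)
  finally show ?thesis .
qed

lemma flat_exp_0_bounds: "0 \<le> flat_exp 0 x" "flat_exp 0 x \<le> 1"
  by (auto simp: flat_exp_def)

lemma bump_bounds: "0 \<le> bump n p q x" "bump n p q x \<le> 1"
  unfolding bump_def using flat_exp_0_bounds by (auto intro!: mult_le_one)

lemma bump_eq_0: "x \<notin> {p<..<q} \<Longrightarrow> bump n p q x = 0"
  by (auto simp: bump_def flat_exp_def zero_less_mult_iff)

lemma bump_pos: "x \<in> {p<..<q} \<Longrightarrow> bump n p q x > 0"
  by (auto simp: bump_def flat_exp_def)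

lemma bump_tendsto: "(\<lambda>n. bump n p q x) \<longlonglongrightarrow> indicator {p<..<q} x"
proof (cases "x \<in> {p<..<q}")
  case True
  then have "x - p > 0" "q - x > 0" by auto
  have "(\<lambda>n. exp (- (1 / (real (Suc n) * a)))) \<longlonglongrightarrow> 1" if "a > 0" for a
    using that by real_asymp
  from tendsto_mult[OF this[OF \<open>x - p > 0\<close>] this[OF \<open>q - x > 0\<close>]]
  show ?thesis using True by (simp add: bump_def flat_exp_def)
qed (simp add: bump_eq_0)

lemma integral_bump_pos: "integral {0..1} (bump 0 0 1) > 0"
proof -
  have "bump 0 0 1 integrable_on {0..1}"
    by (intro integrable_continuous_interval smooth_class_continuous smooth_class_bump)
  moreover have "integral {0..1} (bump 0 0 1) \<noteq> 0"
    using integral_eq_0_iff[of 0 1 "bump 0 0 1"] bump_bounds bump_pos[of "1/2" 0 1 0]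
      smooth_class_continuous[OF smooth_class_bump] by force
  ultimately show ?thesis
    using integral_nonneg[of "bump 0 0 1" "{0..1}"] bump_bounds by fastforce
qed

section \<open>Uniqueness of the displacement\<close>

lemma integrable_mult_compact_support:
  fixes v b :: "real \<Rightarrow> real"
  assumes v: "set_integrable lborel {p..q} v" and b: "continuous_on {p..q} b"
    and supp: "\<And>x. x \<notin> {p..q} \<Longrightarrow> b x = 0"
  shows "integrable lborel (\<lambda>x. v x * b x)"
proof -
  have bb: "bounded (b ` {p..q})"
    by (intro compact_imp_bounded compact_continuous_image b) auto
  then obtain M where M: "\<forall>x\<in>{p..q}. \<bar>b x\<bar> \<le> M"
    unfolding bounded_iff by auto
  have [measurable]: "(\<lambda>x. indicator {p..q} x *\<^sub>R b x) \<in> borel_measurable borel"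
    using b by (intro borel_measurable_continuous_on_indicator) auto
  have [measurable]: "(\<lambda>x. indicator {p..q} x *\<^sub>R v x) \<in> borel_measurable borel"
    using v unfolding set_integrable_def by auto
  \<comment> \<open>Only the restriction of \<open>v\<close> to \<open>{p..q}\<close> is known to be
    measurable, so both factors are cut off there.\<close>
  have eq: "v x * b x = (indicator {p..q} x *\<^sub>R v x) * (indicator {p..q} x *\<^sub>R b x)" for x
    using supp[of x] by (auto simp: indicator_def)
  have "integrable lborel (\<lambda>x. (indicator {p..q} x *\<^sub>R v x) * (indicator {p..q} x *\<^sub>R b x))"
  proof (rule Bochner_Integration.integrable_bound)
    show "integrable lborel (\<lambda>x. M * (indicator {p..q} x *\<^sub>R v x))"
      using v unfolding set_integrable_def by (rule integrable_mult_right)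
    show "AE x in lborel. norm ((indicator {p..q} x *\<^sub>R v x) * (indicator {p..q} x *\<^sub>R b x))
        \<le> norm (M * (indicator {p..q} x *\<^sub>R v x))"
    proof (intro AE_I2)
      fix x
      have "\<bar>v x * b x\<bar> \<le> \<bar>M * v x\<bar>" if "x \<in> {p..q}"
        using bspec[OF M that] by (auto simp: abs_mult mult.commute intro!: mult_right_mono)
      then show "norm ((indicator {p..q} x *\<^sub>R v x) * (indicator {p..q} x *\<^sub>R b x))
        \<le> norm (M * (indicator {p..q} x *\<^sub>R v x))" by (auto simp: indicator_def)
    qed
  qed measurable
  then show ?thesis unfolding eq[symmetric] .
qed

lemma set_integrable_const: "set_integrable lborel {p..q} (\<lambda>x. c :: real)" for p q :: real
  by (rule borel_integrable_atLeastAtMost') auto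

text \<open>A bump minus a multiple of one fixed bump has mean zero, hence is the derivative of a
  test function. Thus \<open>v - K\<close> is orthogonal to all bumps, in the limit has integral
  zero over all intervals, and vanishes almost everywhere by Lebesgue differentiation.\<close>

lemma du_bois_reymond:
  fixes v :: "real \<Rightarrow> real"
  assumes li: "\<And>a b. set_integrable lborel {a..b} v"
    and z: "\<And>\<phi>. test_function \<phi> \<Longrightarrow> (LINT x|lborel. v x * deriv \<phi> x) = 0"
  obtains c where "AE x in lborel. v x = c"
proof -
  define I where "I = integral UNIV (bump 0 0 1)"
  \<comment> \<open>The average of \<open>v\<close> against the fixed bump normalised to mass 1; it
    turns out to be the constant.\<close>
  define K where "K = (LINT x|lborel. v x * bump 0 0 1 x) / I"
  have integral_UNIV: "integral {r..t} (bump n p q) = integral UNIV (bump n p q)"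
    if "r \<le> p" "q \<le> t" for r t p q n
  proof -
    have "integral UNIV (\<lambda>x. if x \<in> {r..t} then bump n p q x else 0) = integral {r..t} (bump n p q)"
      by (rule integral_restrict_UNIV)
    moreover have "(\<lambda>x. if x \<in> {r..t} then bump n p q x else 0) = bump n p q"
      using that by (intro ext) (auto simp: bump_eq_0)
    ultimately show ?thesis by simp
  qed
  have I: "I > 0"
    using integral_bump_pos integral_UNIV[of 0 0 1 1 0] by (simp add: I_def)
  have intb: "integrable lborel (\<lambda>x. f x * bump n p q x)"
    if "\<And>a b. set_integrable lborel {a..b} f" for f n p q
    by (rule integrable_mult_compact_support[of p q])
      (auto intro!: that smooth_class_continuous smooth_class_bump bump_eq_0)
  have vb: "(LINT x|lborel. v x * bump n p q x) = integral UNIV (bump n p q) * K" if "p < q" for n p q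
  proof -
    \<comment> \<open>Chosen so that \<open>?b\<close> has total mass zero.\<close>
    define c where "c = - (integral UNIV (bump n p q) / I)"
    define r where "r = min 0 p"
    define t where "t = max 1 q"
    let ?b = "\<lambda>x. bump n p q x + c * bump 0 0 1 x"
    have sm: "smooth_class ?b" by (intro smooth_class.intros smooth_class_bump)
    have int: "bump m p' q' integrable_on {r..t}" for m p' q'
      by (intro integrable_continuous_interval smooth_class_continuous smooth_class_bump)
    have "integral {r..t} ?b = integral {r..t} (bump n p q) + c * integral {r..t} (bump 0 0 1)"
      using Henstock_Kurzweil_Integration.integral_add[OF int integrable_on_cmult_left[OF int, of c]]
      by simp
    also have "\<dots> = 0"
      using I by (simp add: integral_UNIV r_def t_def c_def I_def)
    finally have "integral {r..t} ?b = 0" .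
    moreover have "?b x = 0" if "x \<notin> {r..t}" for x
    proof -
      from that have "x \<notin> {p<..<q}" "x \<notin> {0<..<1}" by (auto simp: r_def t_def)
      then show ?thesis using bump_eq_0[of x p q n] bump_eq_0[of x 0 1 0] by simp
    qed
    moreover have "r \<le> t" by (simp add: r_def t_def)
    ultimately obtain \<phi> where "test_function \<phi>" "deriv \<phi> = ?b"
      using test_function_primitive[OF sm, of r t] by blast
    with z[of \<phi>] have "0 = (LINT x|lborel. v x * bump n p q x + c * (v x * bump 0 0 1 x))"
      by (simp add: algebra_simps)
    also have "\<dots> = (LINT x|lborel. v x * bump n p q x) + c * (LINT x|lborel. v x * bump 0 0 1 x)"
      using intb[OF li] by simp
    finally show ?thesis using I by (simp add: c_def K_def field_simps)
  qed
  define w where "w x = v x - K" for x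
  have wli: "set_integrable lborel {a..b} w" for a b
    unfolding w_def by (intro set_integral_diff li set_integrable_const)
  have w0: "(LINT x|lborel. w x * bump n p q x) = 0" if "p < q" for n p q
  proof -
    have ib: "integrable lborel (bump n p q)"
      using intb[OF set_integrable_const[of _ _ 1]] by simp
    have "(LINT x|lborel. w x * bump n p q x) =
        (LINT x|lborel. v x * bump n p q x) - K * (LINT x|lborel. bump n p q x)"
      unfolding w_def left_diff_distrib using intb[OF li] ib by simp
    also have "(LINT x|lborel. bump n p q x) = integral UNIV (bump n p q)"
      using integral_lborel[OF ib] by simp
    finally show ?thesis using vb[OF that] by simp
  qed
  have w_int: "integral {p..q} w = 0" if "p < q" for p q
  proof -
    have [measurable]: "(\<lambda>x. indicator {p..q} x *\<^sub>R w x) \<in> borel_measurable borel"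
      using wli[of p q] unfolding set_integrable_def by auto
    have eq: "w x * bump n p q x = (indicator {p..q} x *\<^sub>R w x) * bump n p q x" for x n
      using bump_eq_0[of x p q n] by (cases "x \<in> {p..q}") auto
    have [measurable]: "bump n p q \<in> borel_measurable borel" for n
      by (intro borel_measurable_continuous_onI smooth_class_continuous smooth_class_bump)
    \<comment> \<open>The bumps fill the open interval as \<open>n\<close> grows; the integrable
      dominating function is \<open>w\<close> restricted to the interval.\<close>
    have "(\<lambda>n. LINT x|lborel. (indicator {p..q} x *\<^sub>R w x) * bump n p q x) \<longlonglongrightarrow>
        (LINT x|lborel. (indicator {p..q} x *\<^sub>R w x) * indicator {p<..<q} x)"
    proof (rule integral_dominated_convergence)
      show "integrable lborel (\<lambda>x. norm (indicator {p..q} x *\<^sub>R w x))"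
        using wli[of p q] unfolding set_integrable_def by (rule integrable_norm)
      show "AE x in lborel. (\<lambda>n. (indicator {p..q} x *\<^sub>R w x) * bump n p q x) \<longlonglongrightarrow>
          (indicator {p..q} x *\<^sub>R w x) * indicator {p<..<q} x"
        by (intro AE_I2 tendsto_intros bump_tendsto)
      show "AE x in lborel. norm ((indicator {p..q} x *\<^sub>R w x) * bump n p q x)
          \<le> norm (indicator {p..q} x *\<^sub>R w x)" for n
        using bump_bounds[of n p q] by (auto simp: abs_mult intro!: mult_left_le)
    qed measurable
    then have "(LINT x|lborel. (indicator {p..q} x *\<^sub>R w x) * indicator {p<..<q} x) = 0"
      using w0[OF that] unfolding eq by (simp add: LIMSEQ_const_iff)
    also have "(LINT x|lborel. (indicator {p..q} x *\<^sub>R w x) * indicator {p<..<q} x) =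
        (LINT x|lborel. indicator {p..q} x *\<^sub>R w x)"
    proof (rule integral_cong_AE)
      have "AE x in lborel. x \<noteq> p" "AE x in lborel. x \<noteq> q" by (auto intro: AE_lborel_singleton)
      then show "AE x in lborel. (indicator {p..q} x *\<^sub>R w x) * indicator {p<..<q} x
          = indicator {p..q} x *\<^sub>R w x"
        by eventually_elim (auto simp: indicator_def)
    qed measurable
    finally show ?thesis
      using set_borel_integral_eq_integral(2)[OF wli] by (simp add: set_lebesgue_integral_def)
  qed
  \<comment> \<open>Lebesgue differentiation: off a null set \<open>w x\<close> is the limit of its
    averages over \<open>[x, x + h]\<close>, and all these averages are zero.\<close>
  have "w integrable_on cbox a b" for a b
    using set_borel_integral_eq_integral(1)[OF wli] by simp
  then obtain N where N: "negligible N"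
     "\<And>x e. \<lbrakk>x \<notin> N; 0 < e\<rbrakk> \<Longrightarrow>
        \<exists>d>0. \<forall>h. 0 < h \<and> h < d \<longrightarrow>
           norm (integral (cbox x (x + h *\<^sub>R One)) w /\<^sub>R h ^ DIM(real) - w x) < e"
    by (rule integrable_ccontinuous_explicit) blast
  have "w x = 0" if xN: "x \<notin> N" for x
  proof (rule ccontr)
    assume "w x \<noteq> 0"
    then obtain d where d: "d > 0" "\<And>h. 0 < h \<Longrightarrow> h < d \<Longrightarrow>
        norm (integral (cbox x (x + h *\<^sub>R One)) w /\<^sub>R h ^ DIM(real) - w x) < \<bar>w x\<bar>"
      using N(2)[OF xN, of "\<bar>w x\<bar>"] by auto
    from d(2)[of "d / 2"] d(1) show False by (simp add: w_int)
  qed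
  then have "AE x in lebesgue. w x = 0"
    using N(1) by (intro AE_I'[of N]) (auto simp: negligible_iff_null_sets)
  then have "AE x in lborel. w x = 0" by (simp add: AE_completion_iff)
  then show ?thesis by (intro that[of K]) (simp add: w_def)
qed

lemma test_function_support:
  assumes "test_function \<phi>"
  obtains M where "M > 0" "\<And>x. x \<notin> {-M..M} \<Longrightarrow> \<phi> x = 0" "\<And>x. x \<notin> {-M..M} \<Longrightarrow> deriv \<phi> x = 0"
proof -
  have "bounded (closure {x. \<phi> x \<noteq> 0})"
    using assms compact_imp_bounded unfolding test_function_def by blast
  then have "bounded {x. \<phi> x \<noteq> 0}"
    using bounded_subset closure_subset by blast
  then obtain M where M: "M > 0" "\<forall>x\<in>{x. \<phi> x \<noteq> 0}. norm x \<le> M"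
    unfolding bounded_pos by blast
  have z: "\<phi> x = 0" if "x \<notin> {-M..M}" for x using M(2) that by force
  have "deriv \<phi> x = 0" if "x \<notin> {-M..M}" for x
  proof -
    have "((\<lambda>x. 0) has_real_derivative 0) (at x)" by simp
    then have "(\<phi> has_real_derivative 0) (at x)"
      by (rule has_field_derivative_transform_within_open[where S="- {-M..M}"])
        (use that z in \<open>auto intro!: open_Compl\<close>)
    then show ?thesis by (rule DERIV_imp_deriv)
  qed
  with M(1) z show ?thesis using that by blast
qed

lemma test_function_DERIV:
  "test_function \<phi> \<Longrightarrow> (\<phi> has_real_derivative deriv \<phi> x) (at x)"
  unfolding test_function_def DERIV_deriv_iff_real_differentiable
  by (metis funpow_0)

lemma test_function_continuous_deriv:
  "test_function \<phi> \<Longrightarrow> continuous_on S (deriv \<phi>)"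
  unfolding test_function_def
  by (metis funpow_0 funpow.simps(2) comp_apply continuous_at_imp_continuous_on
      differentiable_imp_continuous_within)

lemma test_function_integrable:
  assumes \<phi>: "test_function \<phi>" and u: "\<And>a b. set_integrable lborel {a..b} u"
  shows "integrable lborel (\<lambda>x. u x * deriv \<phi> x)"
proof -
  obtain M where "\<And>x. x \<notin> {-M..M} \<Longrightarrow> deriv \<phi> x = 0"
    using test_function_support[OF \<phi>] by metis
  then show ?thesis
    using u test_function_continuous_deriv[OF \<phi>] by (intro integrable_mult_compact_support) auto
qed

text \<open>The difference of two displacements has distributional derivative zero, so the du
  Bois-Reymond lemma applies.\<close>

lemma is_displacement_unique:
  assumes u: "is_displacement \<Lambda> X u" and v: "is_displacement \<Lambda> X v"
  obtains c where "AE x in lborel. u x = v x + c"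
proof -
  have li: "set_integrable lborel {a..b} u" "set_integrable lborel {a..b} v" for a b
    using u v by (auto simp: is_displacement_def)
  have *: "(LINT x|lborel. (u x - v x) * deriv \<phi> x) = 0" if "test_function \<phi>" for \<phi>
    using u v that test_function_integrable[OF that] li
    by (simp add: is_displacement_def left_diff_distrib)
  obtain c where "AE x in lborel. u x - v x = c"
    by (rule du_bois_reymond[of "\<lambda>x. u x - v x"]) (use li * in \<open>auto intro: set_integral_diff\<close>)
  then show ?thesis by (intro that[of c]) (auto elim!: eventually_mono simp: algebra_simps)
qed

section \<open>The sawtooth displacement\<close>

lemma set_integrable_borel_bounded:
  fixes f :: "real \<Rightarrow> real"
  assumes [measurable]: "f \<in> borel_measurable borel" and "\<And>x. \<bar>f x\<bar> \<le> c"
  shows "set_integrable lborel {a..b} f"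
proof -
  have c: "c \<ge> 0" using assms(2)[of 0] by linarith
  have "integrable lborel (\<lambda>x. indicator {a..b} x *\<^sub>R f x)"
  proof (rule Bochner_Integration.integrable_bound)
    show "integrable lborel (\<lambda>x. indicator {a..b} x *\<^sub>R c)"
      using set_integrable_const[of a b c] by (simp only: set_integrable_def)
    show "AE x in lborel. norm (indicator {a..b} x *\<^sub>R f x) \<le> norm (indicator {a..b} x *\<^sub>R c)"
      using assms(2) c by (auto simp: indicator_def)
  qed measurable
  then show ?thesis by (simp only: set_integrable_def)
qed

lemma test_function_continuous: "test_function \<phi> \<Longrightarrow> continuous_on S \<phi>"
  by (meson DERIV_continuous_on DERIV_subset subset_UNIV test_function_DERIV has_field_derivative_at_within)

lemma LINT_compact_support:
  fixes f :: "real \<Rightarrow> real"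
  assumes "\<And>x. x \<notin> {a..b} \<Longrightarrow> f x = 0"
  shows "(LINT x|lborel. f x) = (LINT x|lborel. f x * indicator {a..b} x)"
  by (rule Bochner_Integration.integral_cong) (use assms in \<open>auto simp: indicator_def\<close>)

text \<open>The distributional derivative of a unit step at \<open>c\<close> is the Dirac mass at
  \<open>c\<close>; every atom of the dislocation measure arises in this way.\<close>

lemma LINT_halfline_deriv_test:
  assumes "test_function \<phi>"
  shows "(LINT x|lborel. indicator {c..} x * deriv \<phi> x) = - \<phi> c"
proof -
  obtain M where M: "M > 0" "\<And>x. x \<notin> {-M..M} \<Longrightarrow> \<phi> x = 0" "\<And>x. x \<notin> {-M..M} \<Longrightarrow> deriv \<phi> x = 0"
    using test_function_support[OF assms] by metis
  define b where "b = max M c + 1"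
  have "(LINT x|lborel. indicator {c..} x * deriv \<phi> x) =
      (LINT x|lborel. deriv \<phi> x * indicator {c..b} x)"
  proof (rule Bochner_Integration.integral_cong)
    fix x
    show "indicator {c..} x * deriv \<phi> x = deriv \<phi> x * indicator {c..b} x"
    proof (cases "x \<le> b")
      case False
      then have "x \<notin> {-M..M}" by (auto simp: b_def)
      then show ?thesis using M(3)[of x] by simp
    qed (auto simp: indicator_def)
  qed simp
  also have "\<dots> = \<phi> b - \<phi> c"
  proof (rule integral_FTC_Icc_real)
    show "isCont (deriv \<phi>) x" for x
      using test_function_continuous_deriv[OF assms, of UNIV] by (simp add: continuous_on_eq_continuous_at)
  qed (use test_function_DERIV[OF assms] in \<open>auto simp: b_def\<close>)
  also have "\<phi> b = 0" by (rule M) (auto simp: b_def)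
  finally show ?thesis by simp
qed

lemma LINT_deriv_test:
  assumes "test_function \<phi>"
  shows "(LINT x|lborel. deriv \<phi> x) = 0"
proof -
  obtain M where M: "M > 0" "\<And>x. x \<notin> {-M..M} \<Longrightarrow> \<phi> x = 0" "\<And>x. x \<notin> {-M..M} \<Longrightarrow> deriv \<phi> x = 0"
    using test_function_support[OF assms] by metis
  have "(LINT x|lborel. deriv \<phi> x) = (LINT x|lborel. indicator {-M-1..} x * deriv \<phi> x)"
    by (rule Bochner_Integration.integral_cong) (use M(3) in \<open>auto simp: indicator_def\<close>)
  also have "\<dots> = - \<phi> (-M-1)" by (rule LINT_halfline_deriv_test[OF assms])
  also have "\<dots> = 0" using M(2)[of "-M-1"] by simp
  finally show ?thesis .
qed

lemma test_function_integrable_self: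
  assumes "test_function \<phi>" shows "integrable lborel \<phi>"
proof -
  obtain M where M: "M > 0" "\<And>x. x \<notin> {-M..M} \<Longrightarrow> \<phi> x = 0" "\<And>x. x \<notin> {-M..M} \<Longrightarrow> deriv \<phi> x = 0"
    using test_function_support[OF assms] by metis
  have "integrable lborel (\<lambda>x. 1 * \<phi> x)"
    by (rule integrable_mult_compact_support[OF set_integrable_const test_function_continuous[OF assms] M(2)])
  then show ?thesis by simp
qed

text \<open>Integration by parts: the derivative of \<open>x * \<phi> x\<close> has integral zero.
  This produces the part \<open>dx\<close> of the derivative of the displacement.\<close>

lemma LINT_ident_deriv_test:
  assumes "test_function \<phi>"
  shows "(LINT x|lborel. x * deriv \<phi> x) = - (LINT x|lborel. \<phi> x)"
proof -
  obtain M where M: "M > 0" "\<And>x. x \<notin> {-M..M} \<Longrightarrow> \<phi> x = 0" "\<And>x. x \<notin> {-M..M} \<Longrightarrow> deriv \<phi> x = 0"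
    using test_function_support[OF assms] by metis
  let ?a = "- M - 1" and ?b = "M + 1"
  have cont: "continuous_on UNIV \<phi>" "continuous_on UNIV (deriv \<phi>)"
    using assms by (auto intro: test_function_continuous test_function_continuous_deriv)
  have "integrable lborel (\<lambda>x. x * deriv \<phi> x)"
    by (rule test_function_integrable[OF assms]) (rule borel_integrable_atLeastAtMost', auto)
  then have "(LINT x|lborel. x * deriv \<phi> x) + (LINT x|lborel. \<phi> x) = (LINT x|lborel. x * deriv \<phi> x + \<phi> x)"
    using test_function_integrable_self[OF assms] by simp
  also have "\<dots> = (LINT x|lborel. (x * deriv \<phi> x + \<phi> x) * indicator {?a..?b} x)"
    by (rule LINT_compact_support) (use M in auto)
  also have "\<dots> = ?b * \<phi> ?b - ?a * \<phi> ?a"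
  proof (rule integral_FTC_Icc_real)
    show "((\<lambda>x. x * \<phi> x) has_real_derivative x * deriv \<phi> x + \<phi> x) (at x)" for x
      using test_function_DERIV[OF assms, of x] by (auto intro!: derivative_eq_intros)
    show "isCont (\<lambda>x. x * deriv \<phi> x + \<phi> x) x" for x
      using cont by (auto intro!: continuous_intros simp: continuous_on_eq_continuous_at)
  qed (use M in auto)
  also have "\<dots> = 0" using M(2)[of ?a] M(2)[of ?b] by simp
  finally show ?thesis by simp
qed

text \<open>On a bounded range the floor is a finite sum of unit steps. It equals \<open>- K\<close>
  on \<open>[-K, 1 - K)\<close>, so the first step sits at \<open>1 - K\<close>.\<close>

lemma floor_eq_sum_indicator:
  fixes t :: real
  assumes "\<bar>t\<bar> < real K"
  shows "real_of_int \<lfloor>t\<rfloor> = - real K + (\<Sum>k\<in>{1 - int K..int K}. indicator {real_of_int k..} t)"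
proof -
  have "(\<Sum>k\<in>{1 - int K..int K}. indicator {real_of_int k..} t) = (\<Sum>k\<in>{1 - int K..\<lfloor>t\<rfloor>}. 1 :: real)"
  proof (rule sum.mono_neutral_cong_right)
    show "{1 - int K..\<lfloor>t\<rfloor>} \<subseteq> {1 - int K..int K}" using assms by (auto simp: le_floor_iff floor_le_iff)
  qed (auto simp: indicator_def le_floor_iff)
  also have "\<dots> = real_of_int \<lfloor>t\<rfloor> + real K"
  proof -
    have "\<lfloor>t\<rfloor> \<ge> - int K" using assms by (simp add: le_floor_iff)
    then show ?thesis by simp
  qed
  finally show ?thesis by simp
qed

text \<open>The derivative of \<open>frac ((x - a) / L)\<close> is \<open>dx / L\<close> minus the
  Dirac comb on \<open>a + L * k\<close>. The choice of \<open>K\<close> makes the finitely many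
  steps suffice on the support.\<close>

lemma LINT_frac_deriv_test:
  assumes \<phi>: "test_function \<phi>" and supp: "\<And>x. x \<notin> {-M..M} \<Longrightarrow> deriv \<phi> x = 0"
    and L: "L > 0" and K: "L * real K > M + \<bar>a\<bar>"
  shows "(LINT x|lborel. frac ((x - a) / L) * deriv \<phi> x) =
    - (LINT x|lborel. \<phi> x) / L + (\<Sum>k\<in>{1 - int K..int K}. \<phi> (a + L * real_of_int k))"
proof -
  let ?K = "{1 - int K..int K}"
  \<comment> \<open>Where \<open>deriv \<phi>\<close> can be nonzero, the fractional part is an
    affine function minus finitely many steps, and each piece has been integrated above.\<close>
  have eq: "frac ((x - a) / L) * deriv \<phi> x = (1 / L) * (x * deriv \<phi> x) + (real K - a / L) * deriv \<phi> x
      - (\<Sum>k\<in>?K. indicator {a + L * real_of_int k..} x * deriv \<phi> x)" for x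
  proof (cases "x \<in> {-M..M}")
    case True
    have "\<bar>x - a\<bar> < L * real K" using True K by auto
    then have "\<bar>(x - a) / L\<bar> < real K" using L by (simp add: abs_divide divide_less_eq mult.commute)
    moreover have "indicator {real_of_int k..} ((x - a) / L) = (indicator {a + L * real_of_int k..} x :: real)" for k
      using L by (auto simp: indicator_def field_simps)
    moreover define S :: real where "S = (\<Sum>k\<in>?K. indicator {a + L * real_of_int k..} x)"
    ultimately have "real_of_int \<lfloor>(x - a) / L\<rfloor> = - real K + S"
      using floor_eq_sum_indicator[of "(x - a) / L" K] by (simp only:)
    then have fr: "frac ((x - a) / L) = x / L - a / L + real K - S"
      by (simp add: frac_def diff_divide_distrib)
    show ?thesis
      unfolding sum_distrib_right[symmetric] S_def[symmetric] fr by (simp add: algebra_simps)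
  qed (simp add: supp)
  have ind: "integrable lborel (\<lambda>x. indicator {c..} x * deriv \<phi> x)" for c :: real
    by (rule test_function_integrable[OF \<phi>], rule set_integrable_borel_bounded[where c=1]) auto
  have idn: "integrable lborel (\<lambda>x. x * deriv \<phi> x)"
    by (rule test_function_integrable[OF \<phi>]) (rule borel_integrable_atLeastAtMost', auto)
  have one: "integrable lborel (deriv \<phi>)"
    using test_function_integrable[OF \<phi> set_integrable_const[of _ _ 1]] by simp
  have "(LINT x|lborel. frac ((x - a) / L) * deriv \<phi> x) =
      (1 / L) * (LINT x|lborel. x * deriv \<phi> x) + (real K - a / L) * (LINT x|lborel. deriv \<phi> x)
      - (\<Sum>k\<in>?K. (LINT x|lborel. indicator {a + L * real_of_int k..} x * deriv \<phi> x))"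
  proof -
    define f where "f x = (\<Sum>k\<in>?K. indicator {a + L * real_of_int k..} x * deriv \<phi> x)" for x
    have "integrable lborel f"
      unfolding f_def by (intro Bochner_Integration.integrable_sum ind)
    moreover have "(LINT x|lborel. f x) = (\<Sum>k\<in>?K. LINT x|lborel. indicator {a + L * real_of_int k..} x * deriv \<phi> x)"
      unfolding f_def by (intro Bochner_Integration.integral_sum ind)
    ultimately show ?thesis
      unfolding eq f_def[symmetric] using idn one by simp
  qed
  then show ?thesis
    by (simp add: LINT_ident_deriv_test[OF \<phi>] LINT_deriv_test[OF \<phi>] LINT_halfline_deriv_test[OF \<phi>] sum_negf)
qed

lemma borel_measurable_frac [measurable]:
  assumes [measurable]: "f \<in> borel_measurable M"
  shows "(\<lambda>x. frac (f x :: real)) \<in> borel_measurable M"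
  unfolding frac_def by measurable

definition sawtooth :: "nat \<Rightarrow> (nat \<Rightarrow> real) \<Rightarrow> real \<Rightarrow> real"
  where "sawtooth \<Lambda> X x = (\<Sum>i = 1..\<Lambda>. frac ((x - X i) / real \<Lambda>))"

text \<open>Each of the \<open>\<Lambda>\<close> summands has slope \<open>1 / \<Lambda>\<close>, so
  the slopes add up to 1, and the \<open>l\<close>-th summand drops by 1 exactly at the points
  \<open>X l + \<Lambda> * k\<close>.\<close>

lemma is_displacement_sawtooth:
  assumes \<Lambda>: "\<Lambda> \<ge> 1"
  shows "is_displacement \<Lambda> X (sawtooth \<Lambda> X)"
  unfolding is_displacement_def
proof (intro conjI allI impI)
  have frac_int: "set_integrable lborel {a..b} (\<lambda>x. frac ((x - c) / real \<Lambda>))" for a b c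
    by (rule set_integrable_borel_bounded[where c=1]) (auto simp: frac_lt_1 less_imp_le)
  show "set_integrable lborel {a..b} (sawtooth \<Lambda> X)" for a b
    using frac_int unfolding sawtooth_def set_integrable_def scaleR_sum_right
    by (intro Bochner_Integration.integrable_sum)
  fix \<phi> assume \<phi>: "test_function \<phi>"
  obtain M where M: "M > 0" "\<And>x. x \<notin> {-M..M} \<Longrightarrow> \<phi> x = 0" "\<And>x. x \<notin> {-M..M} \<Longrightarrow> deriv \<phi> x = 0"
    using test_function_support[OF \<phi>] by metis
  \<comment> \<open>Large enough for all entries at once, so that one index range serves every
    \<open>l\<close>.\<close>
  obtain K :: nat where K: "M + (\<Sum>l = 1..\<Lambda>. \<bar>X l\<bar>) < real K"
    using reals_Archimedean2 by blast
  let ?K = "{1 - int K..int K}"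
  have Kl: "M + \<bar>X l\<bar> < real \<Lambda> * real K" if "l \<in> {1..\<Lambda>}" for l
  proof -
    have "\<bar>X l\<bar> \<le> (\<Sum>l = 1..\<Lambda>. \<bar>X l\<bar>)" using that by (intro member_le_sum) auto
    moreover have "1 * real K \<le> real \<Lambda> * real K" using \<Lambda> by (intro mult_right_mono) auto
    ultimately show ?thesis using K by linarith
  qed
  have "(LINT x|lborel. sawtooth \<Lambda> X x * deriv \<phi> x) =
      (\<Sum>l = 1..\<Lambda>. LINT x|lborel. frac ((x - X l) / real \<Lambda>) * deriv \<phi> x)"
    unfolding sawtooth_def sum_distrib_right
    by (rule Bochner_Integration.integral_sum) (intro test_function_integrable[OF \<phi>] frac_int)
  also have "\<dots> = (\<Sum>l = 1..\<Lambda>. - (LINT x|lborel. \<phi> x) / real \<Lambda> +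
      (\<Sum>k\<in>?K. \<phi> (X l + real \<Lambda> * real_of_int k)))"
    by (intro sum.cong refl LINT_frac_deriv_test[OF \<phi> M(3)]) (use \<Lambda> Kl in auto)
  also have "\<dots> = - (LINT x|lborel. \<phi> x) + (\<Sum>l = 1..\<Lambda>. \<Sum>k\<in>?K. \<phi> (X l + real \<Lambda> * real_of_int k))"
    using \<Lambda> by (simp add: sum.distrib sum_subtractf)
  also have "(\<Sum>l = 1..\<Lambda>. \<Sum>k\<in>?K. \<phi> (X l + real \<Lambda> * real_of_int k)) =
      (LINT x|dislocation_measure \<Lambda> X. \<phi> x)"
  proof -
    let ?f = "\<lambda>(l, k). \<phi> (X l + real \<Lambda> * real_of_int k)"
    \<comment> \<open>Atoms outside the index range miss the support of \<open>\<phi>\<close>, so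
      the integral over the counting measure is a finite sum.\<close>
    have out: "\<phi> (X l + real \<Lambda> * real_of_int k) = 0" if "l \<in> {1..\<Lambda>}" "k \<notin> ?K" for l k
    proof (rule M(2))
      have "k \<le> - int K \<or> k \<ge> int K" using that by auto
      then have "real_of_int k \<le> - real K \<or> real_of_int k \<ge> real K" by linarith
      then have "real \<Lambda> * real_of_int k \<le> - (real \<Lambda> * real K) \<or> real \<Lambda> * real_of_int k \<ge> real \<Lambda> * real K"
        by (metis mult_left_mono mult_minus_right of_nat_0_le_iff)
      then show "X l + real \<Lambda> * real_of_int k \<notin> {-M..M}"
        using Kl[OF that(1)] by auto
    qed
    have sub: "{a \<in> {1..\<Lambda>} \<times> UNIV. ?f a \<noteq> 0} \<subseteq> {1..\<Lambda>} \<times> ?K"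
    proof
      fix a assume a: "a \<in> {a \<in> {1..\<Lambda>} \<times> UNIV. ?f a \<noteq> 0}"
      obtain l k where "a = (l, k)" by (cases a)
      with a out[of l k] show "a \<in> {1..\<Lambda>} \<times> ?K" by (cases "k \<in> ?K") auto
    qed
    have [measurable]: "\<phi> \<in> borel_measurable borel"
      by (intro borel_measurable_continuous_onI test_function_continuous[OF \<phi>])
    have "(LINT x|dislocation_measure \<Lambda> X. \<phi> x) =
        (LINT a|count_space ({1..\<Lambda>} \<times> UNIV). ?f a)"
      unfolding dislocation_measure_def by (subst integral_distr) (auto simp: case_prod_unfold)
    also have "\<dots> = (\<Sum>a | a \<in> {1..\<Lambda>} \<times> UNIV \<and> ?f a \<noteq> 0. ?f a)"
      by (rule lebesgue_integral_count_space_finite_support) (use finite_subset[OF sub] in auto)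
    also have "\<dots> = (\<Sum>a\<in>{1..\<Lambda>} \<times> ?K. ?f a)"
      by (rule sum.mono_neutral_left) (use sub in auto)
    finally show ?thesis by (simp add: sum.cartesian_product)
  qed
  finally show "(LINT x|lborel. sawtooth \<Lambda> X x * deriv \<phi> x) =
      - ((LINT x|lborel. \<phi> x) - (LINT x|dislocation_measure \<Lambda> X. \<phi> x))" by simp
qed

text \<open>The \<open>SOME\<close> in \<open>displacement\<close> picks a genuine displacement
  because the sawtooth is one. By uniqueness the two differ by a constant off a null set, and the
  constant cancels in \<open>u x - u y\<close>.\<close>

lemma energy_sawtooth:
  assumes "\<Lambda> \<ge> 1"
  shows "energy s \<Lambda> X = 1 / 2 * enn2real (\<integral>\<^sup>+x\<in>{0..<real \<Lambda>}.
      (\<integral>\<^sup>+y. ennreal (\<bar>sawtooth \<Lambda> X x - sawtooth \<Lambda> X y\<bar>\<^sup>2 / \<bar>x - y\<bar> powr (1 + 2 * s)) \<partial>lborel) \<partial>lborel)"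
proof -
  have "is_displacement \<Lambda> X (displacement \<Lambda> X)"
    unfolding displacement_def by (rule someI[where P="is_displacement \<Lambda> X"])
      (rule is_displacement_sawtooth[OF assms])
  then obtain c where c: "AE x in lborel. displacement \<Lambda> X x = sawtooth \<Lambda> X x + c"
    using is_displacement_unique is_displacement_sawtooth[OF assms] by metis
  have "(\<integral>\<^sup>+x\<in>{0..<real \<Lambda>}. (\<integral>\<^sup>+y. ennreal (\<bar>displacement \<Lambda> X x - displacement \<Lambda> X y\<bar>\<^sup>2 /
        \<bar>x - y\<bar> powr (1 + 2 * s)) \<partial>lborel) \<partial>lborel) = (\<integral>\<^sup>+x\<in>{0..<real \<Lambda>}.
      (\<integral>\<^sup>+y. ennreal (\<bar>sawtooth \<Lambda> X x - sawtooth \<Lambda> X y\<bar>\<^sup>2 / \<bar>x - y\<bar> powr (1 + 2 * s)) \<partial>lborel) \<partial>lborel)"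
  proof (rule nn_integral_cong_AE, use c in eventually_elim)
    case (elim x)
    have "(\<integral>\<^sup>+y. ennreal (\<bar>displacement \<Lambda> X x - displacement \<Lambda> X y\<bar>\<^sup>2 / \<bar>x - y\<bar> powr (1 + 2 * s)) \<partial>lborel) =
        (\<integral>\<^sup>+y. ennreal (\<bar>sawtooth \<Lambda> X x - sawtooth \<Lambda> X y\<bar>\<^sup>2 / \<bar>x - y\<bar> powr (1 + 2 * s)) \<partial>lborel)"
      by (rule nn_integral_cong_AE, use c in eventually_elim) (simp add: elim)
    then show ?case by simp
  qed
  then show ?thesis by (simp add: energy_def Let_def)
qed

section \<open>The pair interaction\<close>

lemma integrable_lborel_of_has_integral:
  fixes f :: "real \<Rightarrow> real"
  assumes "f \<in> borel_measurable borel" "\<And>x. 0 \<le> f x" "(f has_integral I) UNIV"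
  shows "integrable lborel f"
proof (rule integrableI_nonneg)
  show "(\<integral>\<^sup>+x. ennreal (f x) \<partial>lborel) < \<infinity>"
    using nn_integral_has_integral_lborel[OF assms] by simp
qed (use assms in auto)

text \<open>The parabola has slopes in \<open>[-1, 1]\<close> on each cell and vanishes at the
  integers, so no jump arises between cells.\<close>

lemma frac_parabola_lipschitz:
  fixes t u :: real
  shows "\<bar>frac t * (1 - frac t) - frac u * (1 - frac u)\<bar> \<le> \<bar>t - u\<bar>"
proof -
  have *: "\<bar>frac t * (1 - frac t) - frac u * (1 - frac u)\<bar> \<le> u - t" if "t \<le> u" for t u :: real
  proof (cases "\<lfloor>t\<rfloor> = \<lfloor>u\<rfloor>")
    case True
    then have "frac u - frac t = u - t" by (simp add: frac_def)
    moreover have "frac t * (1 - frac t) - frac u * (1 - frac u) = (frac u - frac t) * (frac u + frac t - 1)"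
      by (simp add: algebra_simps)
    moreover have "\<bar>frac u + frac t - 1\<bar> \<le> 1"
      using frac_ge_0[of u] frac_ge_0[of t] frac_lt_1[of u] frac_lt_1[of t] by linarith
    ultimately show ?thesis using that by (simp add: abs_mult mult_left_le)
  next
    case False
    then have "\<lfloor>t\<rfloor> + 1 \<le> \<lfloor>u\<rfloor>" using floor_mono[OF that] by linarith
    then have "real_of_int \<lfloor>t\<rfloor> + 1 \<le> real_of_int \<lfloor>u\<rfloor>" by linarith
    \<comment> \<open>With an integer between them, each parabola value is at most the distance to
      the integer after \<open>t\<close>, respectively before \<open>u\<close>; these distances
      together fit into \<open>u - t\<close>.\<close>
    then have "(1 - frac t) + frac u \<le> u - t" by (simp add: frac_def)
    moreover have "frac t * (1 - frac t) \<le> 1 - frac t" "frac u * (1 - frac u) \<le> frac u"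
      "frac t * (1 - frac t) \<ge> 0" "frac u * (1 - frac u) \<ge> 0"
      using frac_ge_0[of u] frac_ge_0[of t] frac_lt_1[of u] frac_lt_1[of t]
      by (auto intro!: mult_nonneg_nonneg mult_left_le mult_left_le_one_le)
    ultimately show ?thesis
      using frac_ge_0[of u] frac_lt_1[of t] by linarith
  qed
  show ?thesis using *[of t u] *[of u t] by (cases "t \<le> u") auto
qed

text \<open>Counts the integers in \<open>(u, v]\<close>. The form of an integral over a counting
  measure prepares for Tonelli.\<close>

lemma floor_diff_eq_nn_integral:
  assumes "u \<le> v"
  shows "ennreal (real_of_int (\<lfloor>v\<rfloor> - \<lfloor>u\<rfloor>)) =
    (\<integral>\<^sup>+k. indicator {k. u < real_of_int k \<and> real_of_int k \<le> v} k \<partial>count_space UNIV)"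
proof -
  have eq: "{k. u < real_of_int k \<and> real_of_int k \<le> v} = {\<lfloor>u\<rfloor><..\<lfloor>v\<rfloor>}"
    by (auto simp: floor_less_iff le_floor_iff)
  have "(\<integral>\<^sup>+k. indicator {\<lfloor>u\<rfloor><..\<lfloor>v\<rfloor>} k \<partial>count_space UNIV) = ennreal (real (card {\<lfloor>u\<rfloor><..\<lfloor>v\<rfloor>}))"
    by (simp add: ennreal_of_nat_eq_real_of_nat)
  also have "\<dots> = ennreal (real_of_int (\<lfloor>v\<rfloor> - \<lfloor>u\<rfloor>))"
    using floor_mono[OF assms] by simp
  finally show ?thesis unfolding eq ..
qed

text \<open>Applied with \<open>p = 1 + 2 * s\<close> and \<open>L = \<Lambda>\<close>, so that the
  range of \<open>p\<close> is that of \<open>s\<close> in \<open>(0, 1/2)\<close>.\<close>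

locale periodic_kernel =
  fixes p L :: real
  assumes p_gt: "1 < p" and p_lt: "p < 2" and L_pos: "L > 0"
begin

text \<open>Near 0 the integrand is of order \<open>1 - p > -1\<close>, at infinity of order
  \<open>- p < -1\<close>. Bounded numerators that are Lipschitz at 0 are therefore integrable
  against the kernel.\<close>

lemma kernel_integrable: "integrable lborel (\<lambda>z::real. min 1 \<bar>z\<bar> / \<bar>z\<bar> powr p)"
proof -
  define f where "f z = indicator {0..1} z * z powr (1 - p)" for z :: real
  define g where "g z = indicator {1..} z * z powr (- p)" for z :: real
  have f_alt: "f = (\<lambda>x. if x \<in> {0..1} then x powr (1 - p) else 0)"
    and g_alt: "g = (\<lambda>x. if x \<in> {1..} then x powr (- p) else 0)"
    by (auto simp: f_def g_def indicator_def)
  have [measurable]: "f \<in> borel_measurable borel" "g \<in> borel_measurable borel"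
    unfolding f_def g_def by measurable
  have "(f has_integral 1 powr (1 - p + 1) / (1 - p + 1)) UNIV"
    unfolding f_alt has_integral_restrict_UNIV by (rule has_integral_powr_from_0) (use p_lt in auto)
  then have f: "integrable lborel f"
    by (rule integrable_lborel_of_has_integral[rotated 2]) (auto simp: f_def)
  have "(g has_integral - (1 powr (- p + 1)) / (- p + 1)) UNIV"
    unfolding g_alt has_integral_restrict_UNIV by (rule has_integral_powr_to_inf) (use p_gt in auto)
  then have g: "integrable lborel g"
    by (rule integrable_lborel_of_has_integral[rotated 2]) (auto simp: g_def)
  \<comment> \<open>The reflected copy covers negative \<open>z\<close>; \<open>0 + -1 * z\<close>
    is the shape of the affine substitution rule.\<close>
  have "integrable lborel (\<lambda>z. (f z + g z) + (f (0 + -1 * z) + g (0 + -1 * z)))"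
    by (intro Bochner_Integration.integrable_add f g lborel_integrable_real_affine) auto
  then show ?thesis
  proof (rule Bochner_Integration.integrable_bound)
    have *: "min 1 y / y powr p \<le> f y + g y" if "y \<ge> 0" for y
    proof (cases "y \<le> 1")
      case True
      have "min 1 y / y powr p = y powr (1 - p)"
        using that True by (cases "y = 0") (auto simp: powr_diff)
      then show ?thesis using that True by (auto simp: f_def g_def)
    next
      case False
      then have "min 1 y / y powr p = y powr (- p)" by (simp add: powr_minus_divide)
      then show ?thesis using that False by (auto simp: f_def g_def)
    qed
    have nn: "f y \<ge> 0" "g y \<ge> 0" for y by (auto simp: f_def g_def)
    show "AE z in lborel. norm (min 1 \<bar>z\<bar> / \<bar>z\<bar> powr p) \<le>
        norm ((f z + g z) + (f (0 + -1 * z) + g (0 + -1 * z)))"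
    proof (intro AE_I2)
      fix z :: real
      have "min 1 \<bar>z\<bar> / \<bar>z\<bar> powr p \<le> (f z + g z) + (f (- z) + g (- z))"
        using *[of z] *[of "- z"] nn[of z] nn[of "- z"] by (cases "z \<ge> 0") auto
      then show "norm (min 1 \<bar>z\<bar> / \<bar>z\<bar> powr p) \<le>
        norm ((f z + g z) + (f (0 + -1 * z) + g (0 + -1 * z)))"
        using nn[of z] nn[of "- z"] by simp
    qed
  qed measurable
qed

lemma kernel_integrable_bound:
  assumes "\<And>z. \<bar>f z\<bar> \<le> M * min 1 \<bar>z\<bar>" and [measurable]: "f \<in> borel_measurable borel"
  shows "integrable lborel (\<lambda>z. f z / \<bar>z\<bar> powr p)"
proof (rule Bochner_Integration.integrable_bound)
  show "integrable lborel (\<lambda>z. M * (min 1 \<bar>z\<bar> / \<bar>z\<bar> powr p))"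
    by (intro integrable_mult_right kernel_integrable)
  have "\<bar>f z\<bar> / \<bar>z\<bar> powr p \<le> \<bar>M * (min 1 \<bar>z\<bar> / \<bar>z\<bar> powr p)\<bar>" for z
  proof -
    have "\<bar>f z\<bar> \<le> \<bar>M * min 1 \<bar>z\<bar>\<bar>" using assms(1)[of z] by linarith
    from divide_right_mono[OF this, of "\<bar>z\<bar> powr p"] show ?thesis by simp
  qed
  then show "AE z in lborel. norm (f z / \<bar>z\<bar> powr p) \<le> norm (M * (min 1 \<bar>z\<bar> / \<bar>z\<bar> powr p))"
    by simp
qed measurable

text \<open>The autocorrelation \<open>\<integral>\<^sub>0\<^sup>L frac (x / L) * frac ((x + r) / L) dx\<close> of the sawtooth.\<close>

definition corr :: "real \<Rightarrow> real"
  where "corr r = L / 3 - L / 2 * (frac (r / L) * (1 - frac (r / L)))"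

lemma corr_minus: "corr (- r) = corr r"
  unfolding corr_def by (simp add: frac_neg)

lemma corr_lipschitz: "\<bar>corr r - corr q\<bar> \<le> \<bar>r - q\<bar> / 2"
proof -
  have "corr r - corr q = L / 2 * (frac (q / L) * (1 - frac (q / L)) - frac (r / L) * (1 - frac (r / L)))"
    by (simp add: corr_def algebra_simps)
  then have "\<bar>corr r - corr q\<bar> = L / 2 * \<bar>frac (q / L) * (1 - frac (q / L)) - frac (r / L) * (1 - frac (r / L))\<bar>"
    using L_pos by (simp only: abs_mult)
  also have "\<dots> \<le> L / 2 * \<bar>q / L - r / L\<bar>"
    using L_pos by (intro mult_left_mono frac_parabola_lipschitz) auto
  also have "\<dots> = \<bar>r - q\<bar> / 2"
    using L_pos by (simp add: diff_divide_distrib[symmetric] abs_divide abs_minus_commute)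
  finally show ?thesis .
qed

lemma corr_bounds: "0 \<le> corr r" "corr r \<le> L"
proof -
  have "frac (r / L) * (1 - frac (r / L)) \<ge> 0"
    using frac_lt_1[of "r / L"] by (intro mult_nonneg_nonneg) auto
  then have 1: "L / 2 * (frac (r / L) * (1 - frac (r / L))) \<ge> 0" using L_pos by simp
  have "frac (r / L) * (1 - frac (r / L)) \<le> 1 / 4"
    using zero_le_power2[of "frac (r / L) - 1 / 2"] by (simp add: power2_eq_square algebra_simps)
  then have "L / 2 * (frac (r / L) * (1 - frac (r / L))) \<le> L / 2 * (1 / 4)"
    using L_pos by (intro mult_left_mono) auto
  with 1 show "0 \<le> corr r" "corr r \<le> L" using L_pos unfolding corr_def by linarith+
qed

text \<open>The Lipschitz bound serves for small \<open>z\<close> and boundedness for large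
  \<open>z\<close>; \<open>1 + L\<close> covers both constants.\<close>

lemma corr_diff_bound: "\<bar>corr r - corr (r + z)\<bar> \<le> (1 + L) * min 1 \<bar>z\<bar>"
proof (cases "\<bar>z\<bar> \<le> 1")
  case True
  have "\<bar>corr r - corr (r + z)\<bar> \<le> \<bar>z\<bar> / 2" using corr_lipschitz[of r "r + z"] by simp
  moreover have "\<bar>z\<bar> / 2 \<le> (1 + L) * \<bar>z\<bar>"
    using L_pos mult_right_mono[of "1 / 2" "1 + L" "\<bar>z\<bar>"] by simp
  ultimately show ?thesis using True by (simp add: min_def)
next
  case False
  have "\<bar>corr r - corr (r + z)\<bar> \<le> L" using corr_bounds[of r] corr_bounds[of "r + z"] by linarith
  then show ?thesis using False by simp
qed

lemma borel_measurable_corr [measurable]: "corr \<in> borel_measurable borel"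
  unfolding corr_def by measurable

lemma corr_integrable: "integrable lborel (\<lambda>z. (corr r - corr (r + z)) / \<bar>z\<bar> powr p)"
  by (rule kernel_integrable_bound[OF corr_diff_bound]) measurable

text \<open>The floor is locally constant off the lattice. The radius \<open>2 * \<delta>\<close>
  leaves room for \<open>r + h + z\<close> with both increments below
  \<open>\<delta>\<close>.\<close>

lemma cell_nbhd:
  assumes "r / L \<notin> \<int>"
  obtains \<delta> where "0 < \<delta>" "\<delta> < 1"
    "\<And>x. \<bar>x - r\<bar> \<le> 2 * \<delta> \<Longrightarrow> \<lfloor>x / L\<rfloor> = \<lfloor>r / L\<rfloor> \<and> x / L \<notin> \<int>"
proof -
  define n where "n = real_of_int \<lfloor>r / L\<rfloor>"
  have "n < r / L" "r / L < n + 1"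
    using assms floor_correct[of "r / L"] unfolding n_def
    by (auto simp: less_le)
  then have n: "L * n < r" "r < L * (n + 1)" using L_pos by (auto simp: field_simps)
  \<comment> \<open>A third of the distance to the ends of the cell keeps the ball of radius
    \<open>2 * \<delta>\<close> strictly inside.\<close>
  define \<delta> where "\<delta> = min (1 / 2) (min (r - L * n) (L * (n + 1) - r) / 3)"
  have "0 < \<delta>" "\<delta> < 1" using n by (auto simp: \<delta>_def min_def)
  moreover have "\<lfloor>x / L\<rfloor> = \<lfloor>r / L\<rfloor> \<and> x / L \<notin> \<int>" if "\<bar>x - r\<bar> \<le> 2 * \<delta>" for x
  proof -
    have "3 * \<delta> \<le> r - L * n" "3 * \<delta> \<le> L * (n + 1) - r"
      unfolding \<delta>_def by (auto simp: min_def)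
    then have "L * n < x" "x < L * (n + 1)" using that \<open>\<delta> > 0\<close> by linarith+
    then have x: "n < x / L" "x / L < n + 1" using L_pos by (auto simp: field_simps)
    then have fl: "\<lfloor>x / L\<rfloor> = \<lfloor>r / L\<rfloor>" by (intro floor_unique) (auto simp: n_def)
    have "x / L \<notin> \<int>"
    proof
      assume "x / L \<in> \<int>"
      then have "real_of_int \<lfloor>x / L\<rfloor> = x / L" by simp
      with fl x show False by (simp add: n_def)
    qed
    with fl show ?thesis by simp
  qed
  ultimately show ?thesis using that by blast
qed

lemma corr_DERIV:
  assumes "r / L \<notin> \<int>"
  shows "(corr has_real_derivative frac (r / L) - 1 / 2) (at r)"
proof -
  obtain \<delta> where \<delta>: "\<delta> > 0" "\<And>x. \<bar>x - r\<bar> \<le> 2 * \<delta> \<Longrightarrow> \<lfloor>x / L\<rfloor> = \<lfloor>r / L\<rfloor> \<and> x / L \<notin> \<int>"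
    using cell_nbhd[OF assms] by metis
  define n where "n = real_of_int \<lfloor>r / L\<rfloor>"
  have "((\<lambda>x. L / 3 - L / 2 * ((x / L - n) * (1 - (x / L - n)))) has_real_derivative frac (r / L) - 1 / 2) (at r)"
    using L_pos by (auto intro!: derivative_eq_intros simp: frac_def n_def field_simps)
  then show ?thesis
  proof (rule has_field_derivative_transform_within_open[where S="ball r \<delta>"])
    fix x assume "x \<in> ball r \<delta>"
    then have "\<lfloor>x / L\<rfloor> = \<lfloor>r / L\<rfloor>" using \<delta>(1) \<delta>(2)[of x]
      by (simp add: dist_real_def abs_minus_commute)
    then show "L / 3 - L / 2 * ((x / L - n) * (1 - (x / L - n))) = corr x"
      by (simp add: corr_def frac_def n_def)
  qed (use \<delta>(1) in auto)
qed

text \<open>\<open>pair_energy\<close>, \<open>pair_force\<close> and \<open>pair_stiffness\<close>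
  are the functions \<open>W\<close>, \<open>W'\<close> and \<open>W''\<close> of the overview;
  \<open>coupling\<close> is twice the last one.\<close>

definition pair_energy :: "real \<Rightarrow> real"
  where "pair_energy r = (LINT z|lborel. (corr r - corr (r + z)) / \<bar>z\<bar> powr p)"

definition pair_force :: "real \<Rightarrow> real"
  where "pair_force r = (LINT z|lborel. (frac (r / L) - frac ((r + z) / L)) / \<bar>z\<bar> powr p)"

definition pair_stiffness :: "real \<Rightarrow> real"
  where "pair_stiffness r = (\<Sum>\<^sub>\<infinity>k\<in>(UNIV :: int set). 1 / \<bar>r + L * real_of_int k\<bar> powr p)"

section \<open>The first derivative of the pair energy\<close>

lemma AE_off_lattice: "AE z in lborel. (r + z) / L \<notin> \<int>"
proof -
  have "countable ((\<lambda>k. L * real_of_int k - r) ` UNIV)" by simp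
  then have "AE z in lborel. z \<notin> (\<lambda>k. L * real_of_int k - r) ` UNIV"
    by (intro AE_not_in countable_imp_null_set_lborel)
  then show ?thesis
  proof eventually_elim
    case (elim z)
    show ?case
    proof
      assume "(r + z) / L \<in> \<int>"
      then obtain k where "(r + z) / L = real_of_int k" by (auto elim: Ints_cases)
      then have "z = L * real_of_int k - r" using L_pos by (simp add: field_simps)
      with elim show False by blast
    qed
  qed
qed

text \<open>A dominating function uniform in \<open>h\<close>. For large \<open>z\<close> the
  Lipschitz bound is used in \<open>h\<close>; for small \<open>z\<close> and large \<open>h\<close>
  it is used in \<open>z\<close>; if both are small, all four points lie in one cell, where
  \<open>corr\<close> is quadratic and the difference is exactly \<open>- h * z / L\<close>.\<close>

lemma corr_second_difference_bound:
  assumes "0 < \<delta>" "\<delta> < 1" "h \<noteq> 0"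
    and cell: "\<And>x. \<bar>x - r\<bar> \<le> 2 * \<delta> \<Longrightarrow> \<lfloor>x / L\<rfloor> = \<lfloor>r / L\<rfloor>"
  shows "\<bar>((corr (r + h) - corr (r + h + z)) - (corr r - corr (r + z))) / h\<bar> \<le>
    (1 / \<delta> + 1 / L) * min 1 \<bar>z\<bar>"
proof -
  let ?D = "(corr (r + h) - corr (r + h + z)) - (corr r - corr (r + z))"
  have m0: "min 1 \<bar>z\<bar> / \<delta> \<le> (1 / \<delta> + 1 / L) * min 1 \<bar>z\<bar>"
    "min 1 \<bar>z\<bar> / L \<le> (1 / \<delta> + 1 / L) * min 1 \<bar>z\<bar>"
    using assms(1) L_pos by (auto simp: distrib_right)
  consider "\<bar>z\<bar> \<ge> \<delta>" | "\<bar>z\<bar> < \<delta>" "\<bar>h\<bar> \<ge> \<delta>" | "\<bar>z\<bar> < \<delta>" "\<bar>h\<bar> < \<delta>" by linarith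
  then have "\<bar>?D / h\<bar> \<le> min 1 \<bar>z\<bar> / \<delta> \<or> \<bar>?D / h\<bar> \<le> min 1 \<bar>z\<bar> / L"
  proof cases
    case 1
    have "?D = (corr (r + h) - corr r) - (corr (r + h + z) - corr (r + z))" by simp
    also have "\<bar>\<dots>\<bar> \<le> \<bar>corr (r + h) - corr r\<bar> + \<bar>corr (r + h + z) - corr (r + z)\<bar>"
      by (rule abs_triangle_ineq4)
    also have "\<dots> \<le> \<bar>h\<bar>"
      using add_mono[OF corr_lipschitz[of "r + h" r] corr_lipschitz[of "r + h + z" "r + z"]] by simp
    finally have "\<bar>?D\<bar> \<le> \<bar>h\<bar>" .
    then have "\<bar>?D / h\<bar> \<le> 1" using \<open>h \<noteq> 0\<close> by (simp add: abs_divide)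
    also have "1 \<le> min 1 \<bar>z\<bar> / \<delta>" using 1 assms by (simp add: min_def)
    finally show ?thesis by simp
  next
    case 2
    have "\<bar>?D\<bar> \<le> \<bar>corr (r + h) - corr (r + h + z)\<bar> + \<bar>corr r - corr (r + z)\<bar>"
      by (rule abs_triangle_ineq4)
    also have "\<dots> \<le> \<bar>z\<bar>"
      using add_mono[OF corr_lipschitz[of "r + h" "r + h + z"] corr_lipschitz[of r "r + z"]] by simp
    finally have "\<bar>?D\<bar> \<le> \<bar>z\<bar>" .
    then have "\<bar>?D / h\<bar> \<le> \<bar>z\<bar> / \<delta>"
      using 2 assms by (auto simp: abs_divide intro!: frac_le)
    then show ?thesis using 2 assms by simp
  next
    case 3
    then have f: "\<lfloor>(r + h) / L\<rfloor> = \<lfloor>r / L\<rfloor>" "\<lfloor>(r + h + z) / L\<rfloor> = \<lfloor>r / L\<rfloor>" "\<lfloor>(r + z) / L\<rfloor> = \<lfloor>r / L\<rfloor>"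
      by (auto intro!: cell)
    have "?D = - (h * z / L)"
      unfolding corr_def frac_def f using L_pos by (simp add: field_simps power2_eq_square)
    then have "\<bar>?D / h\<bar> = \<bar>z\<bar> / L" using \<open>h \<noteq> 0\<close> L_pos by (simp add: abs_mult abs_divide)
    then show ?thesis using 3 assms by simp
  qed
  with m0 show ?thesis by linarith
qed

lemma pair_energy_DERIV:
  assumes r: "r / L \<notin> \<int>"
  shows "(pair_energy has_real_derivative pair_force r) (at r)"
proof -
  obtain \<delta> where \<delta>: "0 < \<delta>" "\<delta> < 1" "\<And>x. \<bar>x - r\<bar> \<le> 2 * \<delta> \<Longrightarrow> \<lfloor>x / L\<rfloor> = \<lfloor>r / L\<rfloor> \<and> x / L \<notin> \<int>"
    using cell_nbhd[OF r] by metis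
  let ?D = "\<lambda>h z. ((corr (r + h) - corr (r + h + z)) - (corr r - corr (r + z))) / h"
  \<comment> \<open>Sequences are used because dominated convergence is a statement about
    sequences.\<close>
  have "((\<lambda>h. (pair_energy (r + h) - pair_energy r) / h) \<longlongrightarrow> pair_force r) (at 0)"
    unfolding tendsto_at_iff_sequentially
  proof (intro allI impI)
    fix X :: "nat \<Rightarrow> real" assume X: "\<forall>i. X i \<in> UNIV - {0}" "X \<longlonglongrightarrow> 0"
    have quot: "(pair_energy (r + X i) - pair_energy r) / X i = (LINT z|lborel. ?D (X i) z / \<bar>z\<bar> powr p)" for i
    proof -
      have "(pair_energy (r + X i) - pair_energy r) / X i =
          (LINT z|lborel. ((corr (r + X i) - corr (r + X i + z)) / \<bar>z\<bar> powr p
            - (corr r - corr (r + z)) / \<bar>z\<bar> powr p) / X i)"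
        unfolding pair_energy_def using corr_integrable by simp
      also have "\<dots> = (LINT z|lborel. ?D (X i) z / \<bar>z\<bar> powr p)"
        by (intro Bochner_Integration.integral_cong) (auto simp: diff_divide_distrib mult.commute)
      finally show ?thesis .
    qed
    have "(\<lambda>i. LINT z|lborel. ?D (X i) z / \<bar>z\<bar> powr p) \<longlonglongrightarrow> pair_force r"
      unfolding pair_force_def
    proof (rule integral_dominated_convergence)
      show "integrable lborel (\<lambda>z. (1 / \<delta> + 1 / L) * (min 1 \<bar>z\<bar> / \<bar>z\<bar> powr p))"
        by (intro integrable_mult_right kernel_integrable)
      show "AE z in lborel. norm (?D (X i) z / \<bar>z\<bar> powr p) \<le> (1 / \<delta> + 1 / L) * (min 1 \<bar>z\<bar> / \<bar>z\<bar> powr p)" for i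
      proof (intro AE_I2)
        fix z
        have "\<bar>?D (X i) z\<bar> \<le> (1 / \<delta> + 1 / L) * min 1 \<bar>z\<bar>"
          using corr_second_difference_bound[OF \<delta>(1,2), of "X i" r z] \<delta>(3) X(1) by blast
        then show "norm (?D (X i) z / \<bar>z\<bar> powr p) \<le> (1 / \<delta> + 1 / L) * (min 1 \<bar>z\<bar> / \<bar>z\<bar> powr p)"
          using divide_right_mono[of "\<bar>?D (X i) z\<bar>" "(1 / \<delta> + 1 / L) * min 1 \<bar>z\<bar>" "\<bar>z\<bar> powr p"]
          by (simp add: abs_divide abs_mult)
      qed
      show "AE z in lborel. (\<lambda>i. ?D (X i) z / \<bar>z\<bar> powr p) \<longlonglongrightarrow>
          (frac (r / L) - frac ((r + z) / L)) / \<bar>z\<bar> powr p"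
        using AE_off_lattice[of r]
      proof eventually_elim
        case (elim z)
        \<comment> \<open>Used at \<open>r\<close> and at \<open>r + z\<close>, both off the lattice
          for almost every \<open>z\<close>; the two constants \<open>1 / 2\<close> then
          cancel.\<close>
        have lim: "(\<lambda>i. (corr (x + X i) - corr x) / X i) \<longlonglongrightarrow> frac (x / L) - 1 / 2" if "x / L \<notin> \<int>" for x
          using corr_DERIV[OF that] X unfolding DERIV_def tendsto_at_iff_sequentially
          by (auto simp: o_def)
        have "(\<lambda>i. (corr (r + X i) - corr r) / X i - (corr ((r + z) + X i) - corr (r + z)) / X i) \<longlonglongrightarrow>
            (frac (r / L) - 1 / 2) - (frac ((r + z) / L) - 1 / 2)"
          by (intro tendsto_diff lim r elim)
        moreover have "(corr (r + h) - corr r) / h - (corr ((r + z) + h) - corr (r + z)) / h = ?D h z" for h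
          by (simp add: diff_divide_distrib add_ac)
        ultimately have "(\<lambda>i. ?D (X i) z) \<longlonglongrightarrow> frac (r / L) - frac ((r + z) / L)"
          by simp
        then have "(\<lambda>i. ?D (X i) z * (1 / \<bar>z\<bar> powr p)) \<longlonglongrightarrow> (frac (r / L) - frac ((r + z) / L)) * (1 / \<bar>z\<bar> powr p)"
          by (rule tendsto_mult_right)
        then show ?case by simp
      qed
    qed measurable
    then show "((\<lambda>h. (pair_energy (r + h) - pair_energy r) / h) \<circ> X) \<longlonglongrightarrow> pair_force r"
      by (simp add: o_def quot)
  qed
  then show ?thesis by (simp add: DERIV_def)
qed


section \<open>Convergence, bounds and continuity of the lattice sum\<close>

text \<open>Independent of \<open>L\<close>, which is what makes the constant of the upper bound uniform in \<open>\<Lambda>\<close>.\<close>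

definition weight_sum :: real
  where "weight_sum = (\<Sum>\<^sub>\<infinity>k\<in>(UNIV :: int set). 1 / (1 + \<bar>real_of_int k\<bar>) powr p)"

lemma weight_summable: "(\<lambda>k::int. 1 / (1 + \<bar>real_of_int k\<bar>) powr p) summable_on UNIV"
proof -
  let ?g = "\<lambda>k::int. 1 / (1 + \<bar>real_of_int k\<bar>) powr p"
  have "summable (\<lambda>n. real (Suc n) powr (- p))"
    using p_gt summable_real_powr_iff[of "- p"] by (subst summable_Suc_iff) auto
  then have "summable (\<lambda>n. norm (1 / (1 + real n) powr p))"
    by (simp add: powr_minus_divide)
  then have N: "(\<lambda>n. 1 / (1 + real n) powr p) summable_on UNIV"
    by (rule norm_summable_imp_summable_on)
  have "?g summable_on (range int)"
    using N by (subst summable_on_reindex) (auto simp: o_def)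
  moreover have "?g summable_on ((\<lambda>n. - int n) ` {0<..})"
    using summable_on_subset_banach[OF N, of "{0<..}"]
    by (subst summable_on_reindex) (auto simp: o_def inj_on_def)
  moreover have "range int \<inter> (\<lambda>n. - int n) ` {0<..} = {}" by auto
  ultimately have "?g summable_on (range int \<union> (\<lambda>n. - int n) ` {0<..})"
    by (rule summable_on_Un_disjoint)
  also have "range int \<union> (\<lambda>n. - int n) ` {0<..} = UNIV"
  proof (intro set_eqI iffI UNIV_I)
    fix k :: int
    show "k \<in> range int \<union> (\<lambda>n. - int n) ` {0<..}"
    proof (cases "k \<ge> 0")
      case True
      then have "k = int (nat k)" by simp
      then show ?thesis by blast
    next
      case False
      then have "k = - int (nat (- k))" "nat (- k) \<in> {0<..}" by auto
      then show ?thesis by blast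
    qed
  qed
  finally show ?thesis .
qed

text \<open>For \<open>k \<noteq> 0\<close> the distance is at least
  \<open>(L - \<bar>t\<bar>) + L * (\<bar>k\<bar> - 1)\<close>, where \<open>m\<close> bounds both
  \<open>L - \<bar>t\<bar>\<close> and \<open>L\<close> from below. Linear growth in
  \<open>k\<close> with factor \<open>m\<close> allows comparison with a sum free of
  \<open>L\<close>.\<close>

lemma lattice_distance_ge:
  assumes "0 \<le> m" "m \<le> \<bar>t\<bar>" "m \<le> L - \<bar>t\<bar>"
  shows "m / 2 * (1 + \<bar>real_of_int k\<bar>) \<le> \<bar>t + L * real_of_int k\<bar>"
proof (cases "k = 0")
  case False
  then have k: "1 \<le> \<bar>real_of_int k\<bar>" by linarith
  have "m / 2 * (1 + \<bar>real_of_int k\<bar>) \<le> m / 2 * (2 * \<bar>real_of_int k\<bar>)"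
    using k assms by (intro mult_left_mono) auto
  also have "\<dots> = m + m * (\<bar>real_of_int k\<bar> - 1)" by (simp add: algebra_simps)
  also have "\<dots> \<le> (L - \<bar>t\<bar>) + L * (\<bar>real_of_int k\<bar> - 1)"
    using k assms by (intro add_mono mult_right_mono) auto
  also have "\<dots> = \<bar>L * real_of_int k\<bar> - \<bar>t\<bar>"
    using L_pos by (simp add: abs_mult algebra_simps)
  also have "\<dots> \<le> \<bar>t + L * real_of_int k\<bar>" by linarith
  finally show ?thesis .
qed (use assms in auto)

text \<open>Reduces \<open>r\<close> to its representative \<open>d\<close> in
  \<open>(0, L)\<close>; shifting the index by \<open>n\<close> costs the factor
  \<open>1 + \<bar>n\<bar>\<close> in \<open>c\<close>.\<close>

lemma lattice_lower_bound:
  assumes "r / L \<notin> \<int>"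
  obtains c where "c > 0" "\<And>k. c * (1 + \<bar>real_of_int k\<bar>) \<le> \<bar>r + L * real_of_int k\<bar>"
proof -
  define d where "d = L * frac (r / L)"
  define n where "n = \<lfloor>r / L\<rfloor>"
  define m where "m = min d (L - d)"
  have "0 < frac (r / L)" "frac (r / L) < 1" using assms by (auto simp: frac_lt_1)
  then have d: "0 < d" "d < L" using L_pos by (auto simp: d_def)
  have r: "r = d + L * real_of_int n" using L_pos by (simp add: d_def n_def frac_def field_simps)
  have m: "m > 0" using d by (auto simp: m_def)
  define c where "c = m / 2 / (1 + \<bar>real_of_int n\<bar>)"
  have "c > 0" using m by (auto simp: c_def intro!: divide_pos_pos)
  moreover have "c * (1 + \<bar>real_of_int k\<bar>) \<le> \<bar>r + L * real_of_int k\<bar>" for k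
  proof -
    \<comment> \<open>Triangle inequality for \<open>k = (n + k) - n\<close>.\<close>
    have "1 + \<bar>real_of_int k\<bar> \<le> (1 + \<bar>real_of_int n\<bar>) * (1 + \<bar>real_of_int (n + k)\<bar>)"
    proof -
      have "1 + \<bar>real_of_int k\<bar> \<le> 1 + \<bar>real_of_int n\<bar> + \<bar>real_of_int (n + k)\<bar>" by simp
      moreover have "0 \<le> \<bar>real_of_int n\<bar> * \<bar>real_of_int (n + k)\<bar>" by simp
      moreover have "(1 + \<bar>real_of_int n\<bar>) * (1 + \<bar>real_of_int (n + k)\<bar>) =
          1 + \<bar>real_of_int n\<bar> + \<bar>real_of_int (n + k)\<bar> + \<bar>real_of_int n\<bar> * \<bar>real_of_int (n + k)\<bar>"
        by (simp only: distrib_left distrib_right mult_1_left mult_1_right add.assoc)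
      ultimately show ?thesis by linarith
    qed
    then have "c * (1 + \<bar>real_of_int k\<bar>) \<le> c * ((1 + \<bar>real_of_int n\<bar>) * (1 + \<bar>real_of_int (n + k)\<bar>))"
      using \<open>c > 0\<close> by (intro mult_left_mono) auto
    also have "\<dots> = m / 2 * (1 + \<bar>real_of_int (n + k)\<bar>)"
    proof -
      have "m / 2 / N * (N * y) = m / 2 * y" if "N \<noteq> 0" for N y :: real
        using that by simp
      moreover have "1 + \<bar>real_of_int n\<bar> \<noteq> 0" by linarith
      ultimately show ?thesis unfolding c_def by blast
    qed
    also have "\<dots> \<le> \<bar>d + L * real_of_int (n + k)\<bar>"
      using d by (intro lattice_distance_ge) (auto simp: m_def)
    also have "d + L * real_of_int (n + k) = r + L * real_of_int k"
      by (subst r) (simp add: algebra_simps)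
    finally show ?thesis .
  qed
  ultimately show ?thesis using that by blast
qed

lemma inverse_powr_bound:
  fixes c w y :: real
  assumes "c > 0" "w > 0" "c * w \<le> y"
  shows "1 / y powr p \<le> 1 / c powr p * (1 / w powr p)"
proof -
  have cw: "0 < c * w" using assms by simp
  then have "0 < y" using assms by linarith
  have "1 / y powr p \<le> 1 / (c * w) powr p"
  proof (rule divide_left_mono)
    show "(c * w) powr p \<le> y powr p" using assms p_gt cw by (intro powr_mono2) auto
    show "0 < y powr p * (c * w) powr p" using assms \<open>0 < y\<close> by simp
  qed simp
  then show ?thesis using assms by (simp add: powr_mult)
qed

text \<open>Termwise comparison, in which \<open>r\<close> and \<open>L\<close> enter only through
  \<open>c\<close>.\<close>

lemma stiffness_bounded_by_weight:
  assumes "c > 0" "\<And>k. c * (1 + \<bar>real_of_int k\<bar>) \<le> \<bar>r + L * real_of_int k\<bar>"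
  shows "(\<lambda>k. 1 / \<bar>r + L * real_of_int k\<bar> powr p) summable_on UNIV"
    and "pair_stiffness r \<le> 1 / c powr p * weight_sum"
proof -
  have le: "1 / \<bar>r + L * real_of_int k\<bar> powr p \<le> 1 / c powr p * (1 / (1 + \<bar>real_of_int k\<bar>) powr p)" for k
    by (rule inverse_powr_bound) (use assms in auto)
  have sm: "(\<lambda>k::int. 1 / c powr p * (1 / (1 + \<bar>real_of_int k\<bar>) powr p)) summable_on UNIV"
    by (intro summable_on_cmult_right weight_summable)
  show 1: "(\<lambda>k. 1 / \<bar>r + L * real_of_int k\<bar> powr p) summable_on UNIV"
    by (rule summable_on_comparison_test[OF sm le]) auto
  show "pair_stiffness r \<le> 1 / c powr p * weight_sum"
    unfolding pair_stiffness_def weight_sum_def infsum_cmult_right'[symmetric]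
    by (rule infsum_mono[OF 1 sm le])
qed

lemma stiffness_summable:
  assumes "r / L \<notin> \<int>"
  shows "(\<lambda>k. 1 / \<bar>r + L * real_of_int k\<bar> powr p) summable_on UNIV"
  using lattice_lower_bound[OF assms] stiffness_bounded_by_weight(1) by metis

lemma pair_stiffness_nonneg: "pair_stiffness r \<ge> 0"
  unfolding pair_stiffness_def by (rule infsum_nonneg) auto

lemma pair_stiffness_minus: "pair_stiffness (- r) = pair_stiffness r"
proof -
  have "bij_betw uminus (UNIV :: int set) UNIV" by (rule bij_uminus)
  then have "pair_stiffness r = (\<Sum>\<^sub>\<infinity>k\<in>(UNIV :: int set). 1 / \<bar>r + L * real_of_int (- k)\<bar> powr p)"
    unfolding pair_stiffness_def by (rule infsum_reindex_bij_betw[symmetric])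
  also have "\<dots> = pair_stiffness (- r)"
    unfolding pair_stiffness_def by (intro infsum_cong) (simp add: abs_minus_commute)
  finally show ?thesis by simp
qed

lemma isCont_pair_stiffness:
  assumes "r / L \<notin> \<int>"
  shows "isCont pair_stiffness r"
proof -
  obtain c where c: "c > 0" "\<And>k. c * (1 + \<bar>real_of_int k\<bar>) \<le> \<bar>r + L * real_of_int k\<bar>"
    using lattice_lower_bound[OF assms] by metis
  \<comment> \<open>Moving \<open>r\<close> by less than \<open>c / 2\<close> costs at most half of
    \<open>c * (1 + \<bar>k\<bar>)\<close>, so one majorant serves the whole ball.\<close>
  have lower: "c / 2 * (1 + \<bar>real_of_int k\<bar>) \<le> \<bar>t + L * real_of_int k\<bar>" if "t \<in> ball r (c / 2)" for t k
  proof -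
    have "c / 2 * 1 \<le> c / 2 * (1 + \<bar>real_of_int k\<bar>)" using c(1) by (intro mult_left_mono) auto
    moreover have "\<bar>t - r\<bar> < c / 2" using that by (simp add: dist_real_def abs_minus_commute)
    ultimately show ?thesis using c(2)[of k] by linarith
  qed
  have "continuous_on (ball r (c / 2)) (\<lambda>t. \<Sum>\<^sub>\<infinity>k\<in>(UNIV :: int set). 1 / \<bar>t + L * real_of_int k\<bar> powr p)"
  proof (rule uniform_limit_theorem)
    show "uniform_limit (ball r (c / 2)) (\<lambda>F t. \<Sum>k\<in>F. 1 / \<bar>t + L * real_of_int k\<bar> powr p)
        (\<lambda>t. \<Sum>\<^sub>\<infinity>k\<in>(UNIV :: int set). 1 / \<bar>t + L * real_of_int k\<bar> powr p) (finite_subsets_at_top UNIV)"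
    proof (rule Weierstrass_m_test_general)
      show "(\<lambda>k::int. 1 / (c / 2) powr p * (1 / (1 + \<bar>real_of_int k\<bar>) powr p)) summable_on UNIV"
        by (intro summable_on_cmult_right weight_summable)
      show "norm (1 / \<bar>t + L * real_of_int k\<bar> powr p) \<le> 1 / (c / 2) powr p * (1 / (1 + \<bar>real_of_int k\<bar>) powr p)"
        if "t \<in> ball r (c / 2)" for k t
        using inverse_powr_bound[of "c / 2" "1 + \<bar>real_of_int k\<bar>", OF _ _ lower[OF that, of k]] c(1)
        by simp
    qed
    have "continuous_on (ball r (c / 2)) (\<lambda>t. 1 / \<bar>t + L * real_of_int k\<bar> powr p)" for k
    proof -
      have nz: "t + L * real_of_int k \<noteq> 0" if "t \<in> ball r (c / 2)" for t
      proof -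
        have "0 < c / 2 * (1 + \<bar>real_of_int k\<bar>)" using c(1) by (intro mult_pos_pos) auto
        then show ?thesis using lower[OF that, of k] by linarith
      qed
      show ?thesis by (intro continuous_intros) (auto simp: nz powr_eq_0_iff)
    qed
    then show "\<forall>\<^sub>F F in finite_subsets_at_top UNIV.
        continuous_on (ball r (c / 2)) (\<lambda>t. \<Sum>k\<in>F. 1 / \<bar>t + L * real_of_int k\<bar> powr p)"
      by (intro always_eventually allI continuous_on_sum) auto
  qed simp
  then have "continuous_on (ball r (c / 2)) pair_stiffness" by (simp only: pair_stiffness_def[abs_def])
  then show ?thesis using c(1) by (simp add: continuous_on_eq_continuous_at)
qed

text \<open>The floor difference counts the \<open>k\<close> with \<open>L * k\<close> in
  \<open>(a + z, x + z]\<close>, that is, with \<open>t = L * k - z\<close> in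
  \<open>(a, x]\<close>. Tonelli and this substitution for each \<open>k\<close> turn
  \<open>\<bar>z\<bar>\<close> into \<open>\<bar>t - L * k\<bar>\<close>, and summing over
  \<open>k\<close> rebuilds the stiffness at \<open>t\<close>.\<close>

lemma nn_integral_floor_diff:
  assumes "a \<le> x" and cell: "\<And>t. t \<in> {a..x} \<Longrightarrow> t / L \<notin> \<int>"
  shows "(\<integral>\<^sup>+z. ennreal (real_of_int (\<lfloor>(x + z) / L\<rfloor> - \<lfloor>(a + z) / L\<rfloor>) / \<bar>z\<bar> powr p) \<partial>lborel) =
    (\<integral>\<^sup>+t\<in>{a<..x}. ennreal (pair_stiffness t) \<partial>lborel)"
proof -
  interpret pair_sigma_finite lborel "count_space (UNIV :: int set)"
    by (intro pair_sigma_finite.intro sigma_finite_lborel sigma_finite_measure_count_space)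
  let ?I = "\<lambda>z k. indicator {z. a + z < L * real_of_int k \<and> L * real_of_int k \<le> x + z} z :: ennreal"
  let ?J = "indicator {a<..x} :: real \<Rightarrow> ennreal"
  have "ennreal (real_of_int (\<lfloor>(x + z) / L\<rfloor> - \<lfloor>(a + z) / L\<rfloor>) / \<bar>z\<bar> powr p) =
      (\<integral>\<^sup>+k. ?I z k * ennreal (1 / \<bar>z\<bar> powr p) \<partial>count_space UNIV)" for z
  proof -
    have le: "(a + z) / L \<le> (x + z) / L" using assms(1) L_pos by (simp add: divide_right_mono)
    have "ennreal (real_of_int (\<lfloor>(x + z) / L\<rfloor> - \<lfloor>(a + z) / L\<rfloor>) / \<bar>z\<bar> powr p) =
        ennreal (real_of_int (\<lfloor>(x + z) / L\<rfloor> - \<lfloor>(a + z) / L\<rfloor>)) * ennreal (1 / \<bar>z\<bar> powr p)"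
      by (subst ennreal_mult''[symmetric]) auto
    also have "\<dots> = (\<integral>\<^sup>+k. indicator {k. (a + z) / L < real_of_int k \<and> real_of_int k \<le> (x + z) / L} k
        * ennreal (1 / \<bar>z\<bar> powr p) \<partial>count_space UNIV)"
      by (subst floor_diff_eq_nn_integral[OF le], subst nn_integral_multc) auto
    also have "\<dots> = (\<integral>\<^sup>+k. ?I z k * ennreal (1 / \<bar>z\<bar> powr p) \<partial>count_space UNIV)"
      using L_pos by (intro nn_integral_cong) (auto simp: indicator_def field_simps)
    finally show ?thesis .
  qed
  then have "(\<integral>\<^sup>+z. ennreal (real_of_int (\<lfloor>(x + z) / L\<rfloor> - \<lfloor>(a + z) / L\<rfloor>) / \<bar>z\<bar> powr p) \<partial>lborel) =
      (\<integral>\<^sup>+z. (\<integral>\<^sup>+k. ?I z k * ennreal (1 / \<bar>z\<bar> powr p) \<partial>count_space UNIV) \<partial>lborel)" by simp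
  also have "\<dots> = (\<integral>\<^sup>+k. (\<integral>\<^sup>+z. ?I z k * ennreal (1 / \<bar>z\<bar> powr p) \<partial>lborel) \<partial>count_space UNIV)"
    by (rule Fubini'[symmetric]) measurable
  also have "\<dots> = (\<integral>\<^sup>+k. (\<integral>\<^sup>+t. ?J t * ennreal (1 / \<bar>t - L * real_of_int k\<bar> powr p) \<partial>lborel) \<partial>count_space UNIV)"
  proof (rule nn_integral_cong)
    fix k :: int
    let ?g = "\<lambda>z. ?I z k * ennreal (1 / \<bar>z\<bar> powr p)"
    have "?g \<in> borel_measurable borel" by measurable
    then have "(\<integral>\<^sup>+z. ?g z \<partial>lborel) = ennreal \<bar>-1\<bar> * (\<integral>\<^sup>+t. ?g (L * real_of_int k + -1 * t) \<partial>lborel)"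
      by (rule nn_integral_real_affine) simp
    also have "\<dots> = (\<integral>\<^sup>+t. ?g (L * real_of_int k + -1 * t) \<partial>lborel)"
      by simp
    also have "\<dots> = (\<integral>\<^sup>+t. ?J t * ennreal (1 / \<bar>t - L * real_of_int k\<bar> powr p) \<partial>lborel)"
      by (intro nn_integral_cong) (auto simp: indicator_def abs_minus_commute)
    finally show "(\<integral>\<^sup>+z. ?I z k * ennreal (1 / \<bar>z\<bar> powr p) \<partial>lborel) =
        (\<integral>\<^sup>+t. ?J t * ennreal (1 / \<bar>t - L * real_of_int k\<bar> powr p) \<partial>lborel)" .
  qed
  also have "\<dots> = (\<integral>\<^sup>+t. (\<integral>\<^sup>+k. ?J t * ennreal (1 / \<bar>t - L * real_of_int k\<bar> powr p) \<partial>count_space UNIV) \<partial>lborel)"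
    by (rule Fubini') measurable
  also have "\<dots> = (\<integral>\<^sup>+t\<in>{a<..x}. ennreal (pair_stiffness t) \<partial>lborel)"
  proof (rule nn_integral_cong)
    fix t
    show "(\<integral>\<^sup>+k. ?J t * ennreal (1 / \<bar>t - L * real_of_int k\<bar> powr p) \<partial>count_space UNIV) =
        ennreal (pair_stiffness t) * indicator {a<..x} t"
    proof (cases "t \<in> {a<..x}")
      case True
      \<comment> \<open>Written at \<open>- t\<close> to match the sign in
        \<open>stiffness_summable\<close>; evenness of the stiffness undoes the reflection.\<close>
      let ?f = "\<lambda>k::int. 1 / \<bar>- t + L * real_of_int k\<bar> powr p"
      have "- t / L \<notin> \<int>" using cell[of t] True by auto
      then have "?f summable_on UNIV" by (rule stiffness_summable)
      then have "Infinite_Sum.abs_summable_on ?f UNIV" by simp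
      then have abs: "Infinite_Set_Sum.abs_summable_on ?f UNIV" by (simp only: abs_summable_equivalent)
      have "(\<integral>\<^sup>+k. ennreal (?f k) \<partial>count_space UNIV) = ennreal (pair_stiffness (- t))"
        using nn_integral_conv_infsetsum[OF abs] infsetsum_infsum[OF abs] by (simp add: pair_stiffness_def)
      moreover have "\<bar>- t + y\<bar> = \<bar>t - y\<bar>" for y by simp
      ultimately show ?thesis using True by (simp add: pair_stiffness_minus)
    qed simp
  qed
  finally show ?thesis .
qed

text \<open>No jump is crossed for \<open>\<bar>z\<bar> < \<delta>\<close>, so the difference is
  linear there; otherwise it is at most 1.\<close>

lemma frac_diff_bound:
  assumes "r / L \<notin> \<int>"
  obtains M where "\<And>z. \<bar>frac (r / L) - frac ((r + z) / L)\<bar> \<le> M * min 1 \<bar>z\<bar>"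
proof -
  obtain \<delta> where \<delta>: "0 < \<delta>" "\<delta> < 1" "\<And>x. \<bar>x - r\<bar> \<le> 2 * \<delta> \<Longrightarrow> \<lfloor>x / L\<rfloor> = \<lfloor>r / L\<rfloor> \<and> x / L \<notin> \<int>"
    using cell_nbhd[OF assms] by metis
  have "\<bar>frac (r / L) - frac ((r + z) / L)\<bar> \<le> (1 / \<delta> + 1 / L) * min 1 \<bar>z\<bar>" for z
  proof (cases "\<bar>z\<bar> < \<delta>")
    case True
    then have f: "\<lfloor>(r + z) / L\<rfloor> = \<lfloor>r / L\<rfloor>" using \<delta>(1) \<delta>(3)[of "r + z"] by simp
    have "frac (r / L) - frac ((r + z) / L) = - (z / L)"
      unfolding frac_def f by (simp add: add_divide_distrib)
    then have "\<bar>frac (r / L) - frac ((r + z) / L)\<bar> = 1 / L * min 1 \<bar>z\<bar>"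
      using True \<delta>(2) L_pos by (simp add: abs_divide)
    also have "\<dots> \<le> (1 / \<delta> + 1 / L) * min 1 \<bar>z\<bar>"
      using \<delta>(1) by (intro mult_right_mono) auto
    finally show ?thesis .
  next
    case False
    have "\<bar>frac (r / L) - frac ((r + z) / L)\<bar> \<le> 1"
      using frac_ge_0[of "r / L"] frac_ge_0[of "(r + z) / L"] frac_lt_1[of "r / L"] frac_lt_1[of "(r + z) / L"]
      by linarith
    also have "1 \<le> 1 / \<delta> * min 1 \<bar>z\<bar>" using False \<delta>(1,2) by (simp add: min_def)
    also have "\<dots> \<le> (1 / \<delta> + 1 / L) * min 1 \<bar>z\<bar>"
      using L_pos by (intro mult_right_mono) auto
    finally show ?thesis .
  qed
  then show ?thesis using that by blast
qed

lemma frac_integrable: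
  assumes "r / L \<notin> \<int>"
  shows "integrable lborel (\<lambda>z. (frac (r / L) - frac ((r + z) / L)) / \<bar>z\<bar> powr p)"
proof -
  obtain M where "\<And>z. \<bar>frac (r / L) - frac ((r + z) / L)\<bar> \<le> M * min 1 \<bar>z\<bar>"
    using frac_diff_bound[OF assms] by metis
  then show ?thesis by (rule kernel_integrable_bound) measurable
qed

text \<open>Differentiating under the integral fails here: the integrand of the force has derivative
  zero in \<open>r\<close> for almost every \<open>z\<close>, and all of the increment comes from
  jumps. Within a cell the linear parts and the floors at \<open>x\<close> and \<open>a\<close>
  cancel, leaving the count of the jumps crossed.\<close>

lemma pair_force_diff:
  assumes "a \<le> x" and cell: "\<And>t. t \<in> {a..x} \<Longrightarrow> t / L \<notin> \<int> \<and> \<lfloor>t / L\<rfloor> = n"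
  shows "pair_force x - pair_force a = integral {a..x} pair_stiffness"
proof -
  let ?G = "\<lambda>z. real_of_int (\<lfloor>(x + z) / L\<rfloor> - \<lfloor>(a + z) / L\<rfloor>) / \<bar>z\<bar> powr p"
  have nl: "x / L \<notin> \<int>" "a / L \<notin> \<int>" and fl: "\<lfloor>x / L\<rfloor> = n" "\<lfloor>a / L\<rfloor> = n"
    using cell[of x] cell[of a] assms(1) by auto
  have eq: "(frac (x / L) - frac ((x + z) / L)) / \<bar>z\<bar> powr p - (frac (a / L) - frac ((a + z) / L)) / \<bar>z\<bar> powr p = ?G z" for z
    unfolding frac_def fl diff_divide_distrib[symmetric] by (simp add: add_divide_distrib)
  have int: "integrable lborel ?G"
    using Bochner_Integration.integrable_diff[OF frac_integrable[OF nl(1)] frac_integrable[OF nl(2)]]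
    unfolding eq .
  have G0: "?G z \<ge> 0" for z
  proof -
    have "\<lfloor>(a + z) / L\<rfloor> \<le> \<lfloor>(x + z) / L\<rfloor>"
      using assms(1) L_pos by (intro floor_mono divide_right_mono) auto
    then show ?thesis by simp
  qed
  have "pair_force x - pair_force a = (LINT z|lborel. ?G z)"
    unfolding pair_force_def eq[symmetric]
    by (rule Bochner_Integration.integral_diff[symmetric]) (intro frac_integrable nl)+
  also have "\<dots> = enn2real (\<integral>\<^sup>+z. ennreal (?G z) \<partial>lborel)"
    using int G0 by (intro integral_eq_nn_integral) auto
  also have "(\<integral>\<^sup>+z. ennreal (?G z) \<partial>lborel) = (\<integral>\<^sup>+t\<in>{a<..x}. ennreal (pair_stiffness t) \<partial>lborel)"
    by (rule nn_integral_floor_diff) (use assms in auto)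
  also have "\<dots> = (\<integral>\<^sup>+t. ennreal (indicator {a..x} t *\<^sub>R pair_stiffness t) \<partial>lborel)"
    by (rule nn_integral_cong_AE, use AE_lborel_singleton[of a] in eventually_elim)
      (auto simp: indicator_def)
  also have "\<dots> = ennreal (integral {a..x} pair_stiffness)"
  proof (rule nn_integral_has_integral_lborel)
    have cont: "continuous_on {a..x} pair_stiffness"
      by (intro continuous_at_imp_continuous_on ballI isCont_pair_stiffness) (use cell in auto)
    then show "(\<lambda>t. indicator {a..x} t *\<^sub>R pair_stiffness t) \<in> borel_measurable borel"
      by (intro borel_measurable_continuous_on_indicator) auto
    have "(pair_stiffness has_integral integral {a..x} pair_stiffness) {a..x}"
      using cont by (intro integrable_integral integrable_continuous_interval)
    then have "((\<lambda>t. if t \<in> {a..x} then pair_stiffness t else 0) has_integral integral {a..x} pair_stiffness) UNIV"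
      unfolding has_integral_restrict_UNIV .
    moreover have "(\<lambda>t. if t \<in> {a..x} then pair_stiffness t else 0) = (\<lambda>t. indicator {a..x} t *\<^sub>R pair_stiffness t)"
      by (auto simp: indicator_def)
    ultimately show "((\<lambda>t. indicator {a..x} t *\<^sub>R pair_stiffness t) has_integral integral {a..x} pair_stiffness) UNIV"
      by simp
  qed (simp add: pair_stiffness_nonneg)
  also have "enn2real (ennreal (integral {a..x} pair_stiffness)) = integral {a..x} pair_stiffness"
  proof (rule enn2real_ennreal)
    show "0 \<le> integral {a..x} pair_stiffness"
      by (rule integral_nonneg[rotated])
        (auto intro!: pair_stiffness_nonneg integrable_continuous_interval continuous_at_imp_continuous_on
          isCont_pair_stiffness dest: cell)
  qed
  finally show ?thesis .
qed

lemma pair_force_DERIV: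
  assumes "r / L \<notin> \<int>"
  shows "(pair_force has_real_derivative pair_stiffness r) (at r)"
proof -
  obtain \<delta> where \<delta>: "0 < \<delta>" "\<And>x. \<bar>x - r\<bar> \<le> 2 * \<delta> \<Longrightarrow> \<lfloor>x / L\<rfloor> = \<lfloor>r / L\<rfloor> \<and> x / L \<notin> \<int>"
    using cell_nbhd[OF assms] by metis
  \<comment> \<open>A base point left of \<open>r\<close> makes increments from \<open>a\<close>
    cover both sides of \<open>r\<close>.\<close>
  define a where "a = r - \<delta>"
  define b where "b = r + \<delta>"
  have cell: "t / L \<notin> \<int> \<and> \<lfloor>t / L\<rfloor> = \<lfloor>r / L\<rfloor>" if "t \<in> {a..b}" for t
  proof -
    have "\<bar>t - r\<bar> \<le> 2 * \<delta>" using that \<delta>(1) by (auto simp: a_def b_def)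
    then show ?thesis using \<delta>(2)[of t] by simp
  qed
  have "((\<lambda>x. integral {a..x} pair_stiffness) has_real_derivative pair_stiffness r) (at r within {a..b})"
    by (rule integral_has_real_derivative)
      (use cell \<delta>(1) in \<open>auto intro!: continuous_at_imp_continuous_on isCont_pair_stiffness simp: a_def b_def\<close>)
  then have "((\<lambda>x. integral {a..x} pair_stiffness) has_real_derivative pair_stiffness r) (at r)"
    using \<delta>(1) by (subst (asm) at_within_interior) (auto simp: a_def b_def)
  then have "((\<lambda>x. pair_force a + integral {a..x} pair_stiffness) has_real_derivative 0 + pair_stiffness r) (at r)"
    by (intro DERIV_add DERIV_const)
  then have "((\<lambda>x. pair_force a + integral {a..x} pair_stiffness) has_real_derivative pair_stiffness r) (at r)"
    by simp
  then show ?thesis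
  proof (rule has_field_derivative_transform_within_open[where S="{a<..<b}"])
    fix x assume "x \<in> {a<..<b}"
    then show "pair_force a + integral {a..x} pair_stiffness = pair_force x"
      using pair_force_diff[of a x "\<lfloor>r / L\<rfloor>"] cell by auto
  qed (use \<delta>(1) in \<open>auto simp: a_def b_def\<close>)
qed

end

section \<open>The energy as a sum of pair interactions\<close>

context periodic_kernel
begin

text \<open>For shifts within one period, \<open>frac ((x - c) / L)\<close> is linear plus the
  indicator of \<open>x < c\<close>. Since \<open>a \<le> b\<close>, the product of the two
  indicators is the one for \<open>a\<close>, and four polynomial integrals remain.\<close>

lemma frac_mult_has_integral_aux:
  assumes "0 \<le> a" "a \<le> b" "b < L"
  shows "((\<lambda>x. frac ((x - a) / L) * frac ((x - b) / L)) has_integral corr (a - b)) {0..L}"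
proof -
  have frac_eq: "frac ((x - c) / L) = (x - c) / L + (if x < c then 1 else 0)"
    if "0 \<le> x" "x < L" "0 \<le> c" "c < L" for x c
  proof (cases "x < c")
    case True
    then have "\<lfloor>(x - c) / L\<rfloor> = -1" using that L_pos by (intro floor_unique) (auto simp: field_simps)
    then show ?thesis using True by (simp add: frac_def)
  next
    case False
    then have "\<lfloor>(x - c) / L\<rfloor> = 0" using that L_pos by (intro floor_unique) (auto simp: field_simps)
    then show ?thesis using False by (simp add: frac_def)
  qed
  have part: "((\<lambda>x. if x \<in> {0..e} then f x else 0) has_integral (g e - g 0)) {0..L}"
    if "0 \<le> e" "e \<le> L" "\<And>x. (g has_real_derivative f x) (at x)" for e and f g :: "real \<Rightarrow> real"
  proof -
    have "(f has_integral (g e - g 0)) {0..e}"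
      by (rule fundamental_theorem_of_calculus)
        (use that in \<open>auto simp: has_real_derivative_iff_has_vector_derivative[symmetric]
          intro: has_field_derivative_at_within\<close>)
    then show ?thesis using that has_integral_restrict[of "{0..e}" "{0..L}" f] by auto
  qed
  \<comment> \<open>The value is left in the form \<open>g e - g 0\<close>, so that
    \<open>part\<close> can read the primitives off it.\<close>
  have "((\<lambda>x. (if x \<in> {0..L} then (x - a) / L * ((x - b) / L) else 0)
      + (if x \<in> {0..b} then (x - a) / L else 0) + (if x \<in> {0..a} then (x - b) / L else 0)
      + (if x \<in> {0..a} then 1 else 0)) has_integral
      ((L ^ 3 / 3 - (a + b) * L\<^sup>2 / 2 + a * b * L) / L\<^sup>2 - (0 ^ 3 / 3 - (a + b) * 0\<^sup>2 / 2 + a * b * 0) / L\<^sup>2)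
      + ((b\<^sup>2 / 2 - a * b) / L - (0\<^sup>2 / 2 - a * 0) / L) + ((a\<^sup>2 / 2 - b * a) / L - (0\<^sup>2 / 2 - b * 0) / L)
      + (a - 0)) {0..L}"
    by (intro has_integral_add part)
      (use assms L_pos in \<open>auto intro!: derivative_eq_intros simp: power2_eq_square field_simps\<close>)
  also have "((L ^ 3 / 3 - (a + b) * L\<^sup>2 / 2 + a * b * L) / L\<^sup>2 - (0 ^ 3 / 3 - (a + b) * 0\<^sup>2 / 2 + a * b * 0) / L\<^sup>2)
      + ((b\<^sup>2 / 2 - a * b) / L - (0\<^sup>2 / 2 - a * 0) / L) + ((a\<^sup>2 / 2 - b * a) / L - (0\<^sup>2 / 2 - b * 0) / L)
      + (a - 0) = L / 3 - L / 2 * ((b - a) / L * (1 - (b - a) / L))"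
    using L_pos by (simp add: field_simps power2_eq_square power3_eq_cube)
  also have "\<dots> = corr (b - a)"
  proof -
    have "frac ((b - a) / L) = (b - a) / L"
      using assms L_pos by (simp add: frac_eq divide_less_eq)
    then show ?thesis by (simp add: corr_def)
  qed
  also have "corr (b - a) = corr (a - b)" using corr_minus[of "a - b"] by simp
  finally show ?thesis
  \<comment> \<open>The formula with closed intervals can fail only at \<open>a\<close>,
    \<open>b\<close> and \<open>L\<close>.\<close>
  proof (rule has_integral_spike_finite[where S="{a, b, L}", rotated 2])
    fix x assume x: "x \<in> {0..L} - {a, b, L}"
    then have "frac ((x - a) / L) = (x - a) / L + (if x \<in> {0..a} then 1 else 0)"
      "frac ((x - b) / L) = (x - b) / L + (if x \<in> {0..b} then 1 else 0)"
      using assms by (auto simp: frac_eq)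
    then show "frac ((x - a) / L) * frac ((x - b) / L) =
      (if x \<in> {0..L} then (x - a) / L * ((x - b) / L) else 0)
      + (if x \<in> {0..b} then (x - a) / L else 0) + (if x \<in> {0..a} then (x - b) / L else 0)
      + (if x \<in> {0..a} then 1 else 0)"
      using x assms by (auto simp: algebra_simps)
  qed simp
qed

lemma frac_shift: "frac ((x - L * of_int n) / L) = frac (x / L)"
proof -
  have "(x - L * of_int n) / L = x / L + of_int (- n)" using L_pos by (simp add: diff_divide_distrib)
  then show ?thesis unfolding frac_def by (simp only: floor_add_int[symmetric])
qed

text \<open>Both sides are \<open>L\<close>-periodic in \<open>a\<close> and in \<open>b\<close>,
  which reduces to shifts in \<open>[0, L)\<close>; evenness of \<open>corr\<close> handles their
  order.\<close>

lemma frac_mult_has_integral: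
  "((\<lambda>x. frac ((x - a) / L) * frac ((x - b) / L)) has_integral corr (a - b)) {0..L}"
proof -
  have reduced: "((\<lambda>x. frac ((x - a) / L) * frac ((x - b) / L)) has_integral corr (a - b)) {0..L}"
    if "0 \<le> a" "a < L" "0 \<le> b" "b < L" for a b
  proof (cases "a \<le> b")
    case False
    then have "((\<lambda>x. frac ((x - b) / L) * frac ((x - a) / L)) has_integral corr (b - a)) {0..L}"
      using that by (intro frac_mult_has_integral_aux) auto
    moreover have "corr (b - a) = corr (a - b)" using corr_minus[of "a - b"] by simp
    ultimately show ?thesis by (simp add: mult.commute)
  qed (use that frac_mult_has_integral_aux in auto)
  define m where "m = \<lfloor>a / L\<rfloor>"
  define n where "n = \<lfloor>b / L\<rfloor>"
  have red: "0 \<le> c - L * of_int \<lfloor>c / L\<rfloor>" "c - L * of_int \<lfloor>c / L\<rfloor> < L" for c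
  proof -
    have "of_int \<lfloor>c / L\<rfloor> * L \<le> c" using pos_le_divide_eq[OF L_pos] of_int_floor_le by blast
    moreover have "c < (of_int \<lfloor>c / L\<rfloor> + 1) * L"
    proof -
      have "c / L < of_int \<lfloor>c / L\<rfloor> + 1" by linarith
      then show ?thesis unfolding pos_divide_less_eq[OF L_pos] .
    qed
    ultimately show "0 \<le> c - L * of_int \<lfloor>c / L\<rfloor>" "c - L * of_int \<lfloor>c / L\<rfloor> < L"
      by (auto simp: algebra_simps)
  qed
  have shift: "frac ((x - (c - L * of_int k)) / L) = frac ((x - c) / L)" for x c and k :: int
    using frac_shift[of "x - c" "- k"] by (simp add: algebra_simps)
  have "corr ((a - L * of_int m) - (b - L * of_int n)) = corr (a - b)"
    using frac_shift[of "a - b" "m - n"] unfolding corr_def by (simp add: algebra_simps)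
  moreover have "((\<lambda>x. frac ((x - (a - L * of_int m)) / L) * frac ((x - (b - L * of_int n)) / L))
      has_integral corr ((a - L * of_int m) - (b - L * of_int n))) {0..L}"
    unfolding m_def n_def by (intro reduced red)
  ultimately show ?thesis by (simp only: shift)
qed

text \<open>Shifting \<open>x\<close> by \<open>z\<close> amounts to replacing \<open>X i\<close> by
  \<open>X i - z\<close>, so every product in the expanded square integrates to a value of
  \<open>corr\<close>. The two mixed sums agree by evenness and exchange of \<open>i\<close> and
  \<open>j\<close>, whence the factor 2.\<close>

lemma square_sum_has_integral:
  fixes X :: "nat \<Rightarrow> real" and I :: "nat set"
  shows "((\<lambda>x. ((\<Sum>i\<in>I. frac ((x - X i) / L)) - (\<Sum>i\<in>I. frac ((x + z - X i) / L)))\<^sup>2) has_integral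
    2 * (\<Sum>i\<in>I. \<Sum>j\<in>I. corr (X i - X j) - corr (X i - X j + z))) {0..L}"
proof -
  let ?A = "\<lambda>i x. frac ((x - X i) / L)"
  let ?B = "\<lambda>i x. frac ((x - (X i - z)) / L)"
  have sq: "((\<Sum>i\<in>I. frac ((x - X i) / L)) - (\<Sum>i\<in>I. frac ((x + z - X i) / L)))\<^sup>2 =
      (\<Sum>i\<in>I. \<Sum>j\<in>I. (?A i x * ?A j x - ?B i x * ?A j x) - (?A i x * ?B j x - ?B i x * ?B j x))" for x
  proof -
    have "(\<Sum>i\<in>I. frac ((x - X i) / L)) - (\<Sum>i\<in>I. frac ((x + z - X i) / L)) = (\<Sum>i\<in>I. ?A i x - ?B i x)"
      by (simp add: sum_subtractf algebra_simps)
    then show ?thesis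
      by (simp only: power2_eq_square sum_product left_diff_distrib right_diff_distrib)
  qed
  have "((\<lambda>x. \<Sum>i\<in>I. \<Sum>j\<in>I. (?A i x * ?A j x - ?B i x * ?A j x) - (?A i x * ?B j x - ?B i x * ?B j x))
    has_integral (\<Sum>i\<in>I. \<Sum>j\<in>I. (corr (X i - X j) - corr ((X i - z) - X j)) -
      (corr (X i - (X j - z)) - corr ((X i - z) - (X j - z))))) {0..L}"
  \<comment> \<open>For infinite \<open>I\<close> all sums are 0 by convention.\<close>
  proof (cases "finite I")
    case True
    then show ?thesis by (intro has_integral_sum has_integral_diff frac_mult_has_integral)
  qed simp
  also have "(\<Sum>i\<in>I. \<Sum>j\<in>I. (corr (X i - X j) - corr ((X i - z) - X j)) -
      (corr (X i - (X j - z)) - corr ((X i - z) - (X j - z)))) =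
      2 * (\<Sum>i\<in>I. \<Sum>j\<in>I. corr (X i - X j) - corr (X i - X j + z))"
  proof -
    have "(\<Sum>i\<in>I. \<Sum>j\<in>I. corr ((X i - z) - X j)) = (\<Sum>i\<in>I. \<Sum>j\<in>I. corr (X j - X i + z))"
      by (intro sum.cong refl) (metis corr_minus minus_diff_eq diff_diff_eq2 add_diff_eq add.commute)
    also have "\<dots> = (\<Sum>i\<in>I. \<Sum>j\<in>I. corr (X i - X j + z))" by (rule sum.swap)
    finally have "(\<Sum>i\<in>I. \<Sum>j\<in>I. corr ((X i - z) - X j)) = (\<Sum>i\<in>I. \<Sum>j\<in>I. corr (X i - X j + z))" .
    moreover have "(X i - z) - (X j - z) = X i - X j" "X i - (X j - z) = X i - X j + z" for i j by simp_all
    moreover have "c - d - (d - c) = 2 * (c - d)" for c d :: real by simp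
    ultimately show ?thesis by (simp only: sum_subtractf)
  qed
  finally show ?thesis by (simp only: sq)
qed

text \<open>Holds for the whole sum, as the integral of a square; single terms can be
  negative.\<close>

lemma corr_sum_nonneg:
  fixes X :: "nat \<Rightarrow> real" and I :: "nat set"
  shows "0 \<le> (\<Sum>i\<in>I. \<Sum>j\<in>I. corr (X i - X j) - corr (X i - X j + z))"
  using has_integral_nonneg[OF square_sum_has_integral[of X I z]] by simp

text \<open>Besides giving the formula, this shows the double integral to be finite, so the
  \<open>enn2real\<close> in \<open>energy\<close> does not collapse it to 0.\<close>

lemma double_integral_eq_pair_energy:
  fixes X :: "nat \<Rightarrow> real" and I :: "nat set"
  defines "u \<equiv> \<lambda>x. \<Sum>i\<in>I. frac ((x - X i) / L)"
  shows "(\<integral>\<^sup>+x\<in>{0..<L}. (\<integral>\<^sup>+y. ennreal (\<bar>u x - u y\<bar>\<^sup>2 / \<bar>x - y\<bar> powr p) \<partial>lborel) \<partial>lborel) =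
    ennreal (2 * (\<Sum>i\<in>I. \<Sum>j\<in>I. pair_energy (X i - X j)))"
proof -
  have [measurable]: "u \<in> borel_measurable borel" unfolding u_def by measurable
  define Q where "Q z = 2 * (\<Sum>i\<in>I. \<Sum>j\<in>I. corr (X i - X j) - corr (X i - X j + z))" for z
  have Q0: "Q z \<ge> 0" for z using corr_sum_nonneg by (simp add: Q_def)
  have "(\<integral>\<^sup>+x\<in>{0..<L}. (\<integral>\<^sup>+y. ennreal (\<bar>u x - u y\<bar>\<^sup>2 / \<bar>x - y\<bar> powr p) \<partial>lborel) \<partial>lborel) =
      (\<integral>\<^sup>+x. (\<integral>\<^sup>+z. ennreal ((u x - u (x + z))\<^sup>2 / \<bar>z\<bar> powr p) * indicator {0..<L} x \<partial>lborel) \<partial>lborel)"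
  proof (rule nn_integral_cong)
    fix x
    have "(\<lambda>y. ennreal (\<bar>u x - u y\<bar>\<^sup>2 / \<bar>x - y\<bar> powr p)) \<in> borel_measurable borel" by measurable
    then have "(\<integral>\<^sup>+y. ennreal (\<bar>u x - u y\<bar>\<^sup>2 / \<bar>x - y\<bar> powr p) \<partial>lborel) =
        ennreal \<bar>1\<bar> * (\<integral>\<^sup>+z. ennreal (\<bar>u x - u (x + 1 * z)\<bar>\<^sup>2 / \<bar>x - (x + 1 * z)\<bar> powr p) \<partial>lborel)"
      by (rule nn_integral_real_affine) simp
    also have "\<dots> = (\<integral>\<^sup>+z. ennreal ((u x - u (x + z))\<^sup>2 / \<bar>z\<bar> powr p) \<partial>lborel)" by simp
    finally show "(\<integral>\<^sup>+y. ennreal (\<bar>u x - u y\<bar>\<^sup>2 / \<bar>x - y\<bar> powr p) \<partial>lborel) * indicator {0..<L} x =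
        (\<integral>\<^sup>+z. ennreal ((u x - u (x + z))\<^sup>2 / \<bar>z\<bar> powr p) * indicator {0..<L} x \<partial>lborel)"
      by (simp add: nn_integral_multc)
  qed
  also have "\<dots> = (\<integral>\<^sup>+z. (\<integral>\<^sup>+x. ennreal ((u x - u (x + z))\<^sup>2 / \<bar>z\<bar> powr p) * indicator {0..<L} x \<partial>lborel) \<partial>lborel)"
    by (rule lborel_pair.Fubini'[symmetric]) measurable
  also have "\<dots> = (\<integral>\<^sup>+z. ennreal (Q z / \<bar>z\<bar> powr p) \<partial>lborel)"
  proof (rule nn_integral_cong)
    fix z
    have int: "(\<integral>\<^sup>+x. ennreal (indicator {0..<L} x * (u x - u (x + z))\<^sup>2) \<partial>lborel) = ennreal (Q z)"
    proof (rule nn_integral_has_integral_lborel)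
      have "((\<lambda>x. (u x - u (x + z))\<^sup>2) has_integral Q z) {0..L}"
        using square_sum_has_integral[of X I z] by (simp only: u_def Q_def)
      then have "((\<lambda>x. if x \<in> {0..L} then (u x - u (x + z))\<^sup>2 else 0) has_integral Q z) UNIV"
        unfolding has_integral_restrict_UNIV .
      then show "((\<lambda>x. indicator {0..<L} x * (u x - u (x + z))\<^sup>2) has_integral Q z) UNIV"
        by (rule has_integral_spike_finite[where S="{L}", rotated 2]) (auto simp: indicator_def)
      show "(\<lambda>x. indicator {0..<L} x * (u x - u (x + z))\<^sup>2) \<in> borel_measurable borel" by measurable
    qed simp
    have "(\<integral>\<^sup>+x. ennreal ((u x - u (x + z))\<^sup>2 / \<bar>z\<bar> powr p) * indicator {0..<L} x \<partial>lborel) =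
        (\<integral>\<^sup>+x. ennreal (1 / \<bar>z\<bar> powr p) * ennreal (indicator {0..<L} x * (u x - u (x + z))\<^sup>2) \<partial>lborel)"
      by (intro nn_integral_cong) (auto simp: indicator_def ennreal_mult''[symmetric])
    also have "\<dots> = ennreal (1 / \<bar>z\<bar> powr p) * (\<integral>\<^sup>+x. ennreal (indicator {0..<L} x * (u x - u (x + z))\<^sup>2) \<partial>lborel)"
      by (rule nn_integral_cmult) measurable
    also have "\<dots> = ennreal (Q z / \<bar>z\<bar> powr p)"
      unfolding int by (subst ennreal_mult'[symmetric]) auto
    finally show "(\<integral>\<^sup>+x. ennreal ((u x - u (x + z))\<^sup>2 / \<bar>z\<bar> powr p) * indicator {0..<L} x \<partial>lborel) =
        ennreal (Q z / \<bar>z\<bar> powr p)" .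
  qed
  also have "\<dots> = ennreal (LINT z|lborel. Q z / \<bar>z\<bar> powr p)"
  proof (rule nn_integral_eq_integral)
    show "integrable lborel (\<lambda>z. Q z / \<bar>z\<bar> powr p)"
      unfolding Q_def times_divide_eq_right[symmetric] sum_divide_distrib
      by (intro integrable_mult_right Bochner_Integration.integrable_sum corr_integrable)
  qed (use Q0 in auto)
  also have "(LINT z|lborel. Q z / \<bar>z\<bar> powr p) = 2 * (\<Sum>i\<in>I. \<Sum>j\<in>I. pair_energy (X i - X j))"
    unfolding Q_def times_divide_eq_right[symmetric] sum_divide_distrib pair_energy_def
    by (simp add: corr_integrable del: times_divide_eq_right)
  finally show ?thesis .
qed

lemma pair_energy_sum_nonneg:
  fixes X :: "nat \<Rightarrow> real" and I :: "nat set"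
  shows "0 \<le> (\<Sum>i\<in>I. \<Sum>j\<in>I. pair_energy (X i - X j))"
proof -
  have "(\<Sum>i\<in>I. \<Sum>j\<in>I. pair_energy (X i - X j)) =
      (LINT z|lborel. (\<Sum>i\<in>I. \<Sum>j\<in>I. corr (X i - X j) - corr (X i - X j + z)) / \<bar>z\<bar> powr p)"
    unfolding sum_divide_distrib pair_energy_def by (simp add: corr_integrable)
  also have "\<dots> \<ge> 0"
    by (intro Bochner_Integration.integral_nonneg divide_nonneg_nonneg corr_sum_nonneg) auto
  finally show ?thesis .
qed

end

text \<open>Valid for every \<open>X\<close>: derivatives evaluate the energy at perturbed
  configurations, whose entries may leave \<open>[0, \<Lambda>)\<close>.\<close>

lemma energy_eq_pair_energy:
  assumes "0 < s" "s < 1 / 2" "\<Lambda> \<ge> 1"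
  shows "energy s \<Lambda> X =
    (\<Sum>i = 1..\<Lambda>. \<Sum>j = 1..\<Lambda>. periodic_kernel.pair_energy (1 + 2 * s) (real \<Lambda>) (X i - X j))"
proof -
  interpret periodic_kernel "1 + 2 * s" "real \<Lambda>" by unfold_locales (use assms in auto)
  show ?thesis
    using double_integral_eq_pair_energy[of X "{1..\<Lambda>}"] pair_energy_sum_nonneg[of X "{1..\<Lambda>}"]
    by (simp add: energy_sawtooth[OF assms(3)] sawtooth_def)
qed

section \<open>The Hessian\<close>

text \<open>The weights \<open>c\<close> absorb the factors from the chain rule, so one
  differentiation lemma serves for both derivatives.\<close>

definition pair_sum :: "nat \<Rightarrow> (nat \<Rightarrow> nat \<Rightarrow> real) \<Rightarrow> (real \<Rightarrow> real) \<Rightarrow> (nat \<Rightarrow> real) \<Rightarrow> real"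
  where "pair_sum n c F y = (\<Sum>a = 1..n. \<Sum>b = 1..n. c a b * F (y a - y b))"

definition pair_domain :: "nat \<Rightarrow> real set \<Rightarrow> (nat \<Rightarrow> real) set"
  where "pair_domain n D = {y. \<forall>a\<in>{1..n}. \<forall>b\<in>{1..n}. a \<noteq> b \<longrightarrow> y a - y b \<in> D}"

text \<open>The derivative of \<open>y a - y b\<close> with respect to the coordinate \<open>y j\<close>.\<close>

definition direction :: "nat \<Rightarrow> nat \<Rightarrow> nat \<Rightarrow> real"
  where "direction j a b = of_bool (a = j) - of_bool (b = j)"

text \<open>Chain rule for each pair. Diagonal terms are constant in \<open>y\<close> and
  \<open>direction j a a\<close> is 0, so nothing is asked of \<open>F\<close> at 0, where the
  interaction is singular.\<close>

lemma pair_sum_DERIV: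
  assumes F: "\<And>r. r \<in> D \<Longrightarrow> (F has_real_derivative G r) (at r)" and y: "y \<in> pair_domain n D"
  shows "((\<lambda>t. pair_sum n c F (y(j := t))) has_real_derivative
    pair_sum n (\<lambda>a b. c a b * direction j a b) G y) (at (y j))"
  unfolding pair_sum_def
proof (intro DERIV_sum)
  fix a b assume ab: "a \<in> {1..n}" "b \<in> {1..n}"
  show "((\<lambda>t. c a b * F ((y(j := t)) a - (y(j := t)) b)) has_real_derivative
      c a b * direction j a b * G (y a - y b)) (at (y j))"
  proof (cases "a = b")
    case False
    have "((\<lambda>t. (y(j := t)) a - (y(j := t)) b) has_real_derivative direction j a b) (at (y j))"
      using False by (auto intro!: derivative_eq_intros simp: direction_def)
    moreover have "(F has_real_derivative G (y a - y b)) (at ((y(j := y j)) a - (y(j := y j)) b))"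
      using F y ab False by (simp add: pair_domain_def)
    ultimately have "((\<lambda>t. F ((y(j := t)) a - (y(j := t)) b)) has_real_derivative
        G (y a - y b) * direction j a b) (at (y j))"
      by (intro DERIV_chain2)
    from DERIV_cmult[OF this, of "c a b"] show ?thesis by (simp add: mult_ac)
  qed (simp add: direction_def)
qed

lemma open_pair_domain:
  assumes "open D" shows "open (pair_domain n D)"
proof -
  have "open {y :: nat \<Rightarrow> real. y a - y b \<in> D}" for a b
    using assms by (intro open_vimage[where f="\<lambda>y. y a - y b", unfolded vimage_def])
      (auto intro!: continuous_intros continuous_on_product_coordinates)
  then have "open (\<Inter>(a, b)\<in>{(a, b). a \<in> {1..n} \<and> b \<in> {1..n} \<and> a \<noteq> b}. {y :: nat \<Rightarrow> real. y a - y b \<in> D})"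
  proof (intro open_INT)
    show "finite {(a, b). a \<in> {1..n} \<and> b \<in> {1..n} \<and> a \<noteq> b}"
      by (rule finite_subset[of _ "{1..n} \<times> {1..n}"]) auto
  qed auto
  also have "(\<Inter>(a, b)\<in>{(a, b). a \<in> {1..n} \<and> b \<in> {1..n} \<and> a \<noteq> b}. {y :: nat \<Rightarrow> real. y a - y b \<in> D}) = pair_domain n D"
    by (auto simp: pair_domain_def)
  finally show ?thesis .
qed

lemma open_coordinate_slice:
  fixes U :: "(nat \<Rightarrow> real) set"
  assumes "open U" shows "open {t. y(i := t) \<in> U}"
proof -
  have "continuous_on UNIV (\<lambda>t. y(i := t))"
  proof (rule continuous_on_coordinatewise_then_product)
    fix k show "continuous_on UNIV (\<lambda>t. (y(i := t)) k)"
      by (cases "k = i") auto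
  qed
  then show ?thesis using assms open_vimage[of U "\<lambda>t. y(i := t)"] by (simp add: vimage_def)
qed

lemma continuous_on_pair_sum:
  assumes "continuous_on D F"
  shows "continuous_on (pair_domain n D) (pair_sum n c F)"
  unfolding pair_sum_def
proof (intro continuous_on_sum continuous_on_mult continuous_on_const)
  fix a b assume ab: "a \<in> {1..n}" "b \<in> {1..n}"
  show "continuous_on (pair_domain n D) (\<lambda>y. F (y a - y b))"
  proof (cases "a = b")
    case False
    have "continuous_on (pair_domain n D) (\<lambda>y. y a - y b)"
      by (intro continuous_intros continuous_on_subset[OF continuous_on_product_coordinates]) auto
    then show ?thesis
      by (rule continuous_on_compose2[OF assms]) (use ab False in \<open>auto simp: pair_domain_def\<close>)
  qed simp
qed

locale pair_interaction =
  fixes n :: nat and D :: "real set" and W V S :: "real \<Rightarrow> real" and f :: "(nat \<Rightarrow> real) \<Rightarrow> real"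
  assumes open_D: "open D"
    and W_DERIV: "\<And>r. r \<in> D \<Longrightarrow> (W has_real_derivative V r) (at r)"
    and V_DERIV: "\<And>r. r \<in> D \<Longrightarrow> (V has_real_derivative S r) (at r)"
    and S_cont: "continuous_on D S"
    and f_eq: "\<And>y. f y = pair_sum n (\<lambda>a b. 1) W y"
begin

lemma partial_deriv_eq:
  assumes "y \<in> pair_domain n D"
  shows "((\<lambda>t. f (y(j := t))) has_real_derivative pair_sum n (direction j) V y) (at (y j))"
    and "partial_deriv j f y = pair_sum n (direction j) V y"
proof -
  show "((\<lambda>t. f (y(j := t))) has_real_derivative pair_sum n (direction j) V y) (at (y j))"
    using pair_sum_DERIV[OF W_DERIV assms, where c="\<lambda>a b. 1" and j=j] unfolding f_eq by simp
  then show "partial_deriv j f y = pair_sum n (direction j) V y"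
    unfolding partial_deriv_def by (rule DERIV_imp_deriv)
qed

text \<open>The formula for the first partial derivative is valid on an open domain, hence near
  \<open>y i\<close> along the coordinate line, and can be differentiated again.\<close>

lemma hessian_eq:
  assumes "y \<in> pair_domain n D"
  shows "((\<lambda>t. partial_deriv j f (y(i := t))) has_real_derivative
      pair_sum n (\<lambda>a b. direction j a b * direction i a b) S y) (at (y i))"
    and "hessian f y i j = pair_sum n (\<lambda>a b. direction j a b * direction i a b) S y"
proof -
  show "((\<lambda>t. partial_deriv j f (y(i := t))) has_real_derivative
      pair_sum n (\<lambda>a b. direction j a b * direction i a b) S y) (at (y i))"
  proof (rule has_field_derivative_transform_within_open)
    show "((\<lambda>t. pair_sum n (direction j) V (y(i := t))) has_real_derivative
        pair_sum n (\<lambda>a b. direction j a b * direction i a b) S y) (at (y i))"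
      by (rule pair_sum_DERIV[OF V_DERIV assms])
    show "open {t. y(i := t) \<in> pair_domain n D}"
      by (intro open_coordinate_slice open_pair_domain open_D)
    show "y i \<in> {t. y(i := t) \<in> pair_domain n D}" using assms by simp
    show "pair_sum n (direction j) V (y(i := t)) = partial_deriv j f (y(i := t))"
      if "t \<in> {t. y(i := t) \<in> pair_domain n D}" for t
      using that partial_deriv_eq(2) by simp
  qed
  then show "hessian f y i j = pair_sum n (\<lambda>a b. direction j a b * direction i a b) S y"
    unfolding hessian_def partial_deriv_def[of i] by (rule DERIV_imp_deriv)
qed

lemma C2_near_pair_domain:
  assumes "x \<in> pair_domain n D" shows "C2_near n f x"
  unfolding C2_near_def
proof (intro exI[of _ "pair_domain n D"] conjI ballI)
  show "open (pair_domain n D)" by (intro open_pair_domain open_D)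
  fix y i j assume "y \<in> pair_domain n D"
  then show "(\<lambda>t. f (y(j := t))) differentiable (at (y j))"
    "(\<lambda>t. partial_deriv j f (y(i := t))) differentiable (at (y i))"
    using partial_deriv_eq(1) hessian_eq(1) real_differentiable_def by blast+
next
  fix i j
  show "continuous_on (pair_domain n D) (\<lambda>y. hessian f y i j)"
    using continuous_on_pair_sum[OF S_cont, of n "\<lambda>a b. direction j a b * direction i a b"]
    by (rule continuous_on_eq) (simp add: hessian_eq(2))
qed (rule assms)

text \<open>Pairing \<open>direction j a b\<close> with \<open>h j\<close> gives
  \<open>h a - h b\<close>. Once the sums over \<open>i\<close> and \<open>j\<close> are moved
  inside those over the pair, they factor into the square of this difference.\<close>

lemma hessian_form_eq:
  assumes "x \<in> pair_domain n D"
  shows "hessian_form n f x h = (\<Sum>a = 1..n. \<Sum>b = 1..n. S (x a - x b) * (h a - h b)\<^sup>2)"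
proof -
  let ?N = "{1..n}"
  have dir: "(\<Sum>j\<in>?N. direction j a b * h j) = h a - h b" if "a \<in> ?N" "b \<in> ?N" for a b
  proof -
    have "(\<Sum>j\<in>?N. direction j a b * h j) = (\<Sum>j\<in>?N. (if j = a then h j else 0) - (if j = b then h j else 0))"
      by (intro sum.cong) (auto simp: direction_def)
    then show ?thesis using that by (simp add: sum_subtractf)
  qed
  have "hessian_form n f x h = (\<Sum>i\<in>?N. \<Sum>j\<in>?N. \<Sum>a\<in>?N. \<Sum>b\<in>?N.
      S (x a - x b) * ((direction i a b * h i) * (direction j a b * h j)))"
    unfolding hessian_form_def hessian_eq(2)[OF assms] pair_sum_def sum_distrib_right
    by (intro sum.cong refl) (simp add: mult_ac)
  also have "\<dots> = (\<Sum>i\<in>?N. \<Sum>a\<in>?N. \<Sum>j\<in>?N. \<Sum>b\<in>?N.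
      S (x a - x b) * ((direction i a b * h i) * (direction j a b * h j)))"
    by (intro sum.cong refl sum.swap)
  also have "\<dots> = (\<Sum>a\<in>?N. \<Sum>i\<in>?N. \<Sum>j\<in>?N. \<Sum>b\<in>?N.
      S (x a - x b) * ((direction i a b * h i) * (direction j a b * h j)))"
    by (rule sum.swap)
  also have "\<dots> = (\<Sum>a\<in>?N. \<Sum>i\<in>?N. \<Sum>b\<in>?N. \<Sum>j\<in>?N.
      S (x a - x b) * ((direction i a b * h i) * (direction j a b * h j)))"
    by (intro sum.cong refl sum.swap)
  also have "\<dots> = (\<Sum>a\<in>?N. \<Sum>b\<in>?N. \<Sum>i\<in>?N. \<Sum>j\<in>?N.
      S (x a - x b) * ((direction i a b * h i) * (direction j a b * h j)))"
    by (intro sum.cong refl sum.swap)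
  also have "\<dots> = (\<Sum>a\<in>?N. \<Sum>b\<in>?N. S (x a - x b) *
      ((\<Sum>i\<in>?N. direction i a b * h i) * (\<Sum>j\<in>?N. direction j a b * h j)))"
    by (simp only: sum_distrib_left[symmetric] sum_product)
  also have "\<dots> = (\<Sum>a\<in>?N. \<Sum>b\<in>?N. S (x a - x b) * (h a - h b)\<^sup>2)"
    by (intro sum.cong refl) (simp only: dir power2_eq_square)
  finally show ?thesis .
qed

end

text \<open>Each unordered pair is represented by its increasing ordering; the factor 2 becomes the
  one in \<open>coupling\<close>.\<close>

lemma sum_pairs_symmetric:
  fixes g :: "'a::linorder \<Rightarrow> 'a \<Rightarrow> real"
  assumes "finite A" and sym: "\<And>x y. g x y = g y x" and diag: "\<And>x. g x x = 0"
  shows "(\<Sum>x\<in>A. \<Sum>y\<in>A. g x y) = (\<Sum>(x, y)\<in>{(x, y). x \<in> A \<and> y \<in> A \<and> x < y}. 2 * g x y)"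
proof -
  let ?P = "{(x, y). x \<in> A \<and> y \<in> A \<and> x < y}"
  let ?Q = "{(x, y). x \<in> A \<and> y \<in> A \<and> y < x}"
  have fin: "finite ?P" "finite ?Q"
    by (rule finite_subset[of _ "A \<times> A"]; use assms(1) in auto)+
  have "(\<Sum>x\<in>A. \<Sum>y\<in>A. g x y) = (\<Sum>(x, y)\<in>A \<times> A. g x y)"
    by (simp add: sum.cartesian_product)
  also have "\<dots> = (\<Sum>(x, y)\<in>?P \<union> ?Q. g x y)"
  proof (rule sum.mono_neutral_right)
    show "\<forall>i\<in>A \<times> A - (?P \<union> ?Q). (case i of (x, y) \<Rightarrow> g x y) = 0"
    proof
      fix i assume i: "i \<in> A \<times> A - (?P \<union> ?Q)"
      obtain x y where xy: "i = (x, y)" by (cases i)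
      with i have "\<not> x < y" "\<not> y < x" by auto
      then have "x = y" by (meson neqE)
      then show "(case i of (x, y) \<Rightarrow> g x y) = 0" by (simp add: xy diag)
    qed
  qed (use assms(1) in auto)
  also have "\<dots> = (\<Sum>(x, y)\<in>?P. g x y) + (\<Sum>(x, y)\<in>?Q. g x y)"
    by (rule sum.union_disjoint) (use fin in auto)
  also have "(\<Sum>(x, y)\<in>?Q. g x y) = (\<Sum>(x, y)\<in>?P. g x y)"
    by (rule sum.reindex_bij_witness[where i=prod.swap and j=prod.swap]) (auto simp: sym)
  also have "(\<Sum>(x, y)\<in>?P. g x y) + (\<Sum>(x, y)\<in>?P. g x y) = (\<Sum>(x, y)\<in>?P. 2 * g x y)"
    by (simp add: sum_distrib_left[symmetric] case_prod_unfold)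
  finally show ?thesis .
qed

text \<open>For \<open>h\<close> of sum zero the right side is \<open>2 * n\<close> times the
  squared norm, which supplies the constant of the lower bound.\<close>

lemma sum_square_differences:
  fixes h :: "nat \<Rightarrow> real"
  shows "(\<Sum>a = 1..n. \<Sum>b = 1..n. (h a - h b)\<^sup>2) = 2 * real n * (\<Sum>l = 1..n. (h l)\<^sup>2) - 2 * (\<Sum>l = 1..n. h l)\<^sup>2"
proof -
  have "(\<Sum>a = 1..n. \<Sum>b = 1..n. (h a - h b)\<^sup>2) =
      (\<Sum>a = 1..n. \<Sum>b = 1..n. ((h a)\<^sup>2 + (h b)\<^sup>2) - 2 * (h a * h b))"
    by (simp add: power2_diff mult_ac)
  also have "\<dots> = (\<Sum>a = 1..n. \<Sum>b = 1..n. (h a)\<^sup>2) + (\<Sum>a = 1..n. \<Sum>b = 1..n. (h b)\<^sup>2) -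
      2 * (\<Sum>a = 1..n. \<Sum>b = 1..n. h a * h b)"
    by (simp only: sum_subtractf sum.distrib sum_distrib_left)
  also have "(\<Sum>a = 1..n. \<Sum>b = 1..n. h a * h b) = (\<Sum>l = 1..n. h l)\<^sup>2"
    by (simp add: power2_eq_square sum_product)
  finally show ?thesis by (simp add: sum_distrib_left[symmetric])
qed

lemma index_of_eq: "inj_on X {1..\<Lambda>} \<Longrightarrow> l \<in> {1..\<Lambda>} \<Longrightarrow> index_of \<Lambda> X (X l) = l"
  unfolding index_of_def by (rule the_equality) (auto dest: inj_onD)

section \<open>Bounds for the stiffness\<close>

context periodic_kernel
begin

lemma off_lattice:
  assumes "0 < \<bar>r\<bar>" "\<bar>r\<bar> < L" shows "r / L \<notin> \<int>"
proof
  assume "r / L \<in> \<int>"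
  then obtain k where "r / L = of_int k" by (auto elim: Ints_cases)
  then have r: "r = L * of_int k" using L_pos by (simp add: field_simps)
  then have "k \<noteq> 0" using assms(1) by auto
  then have "1 \<le> \<bar>real_of_int k\<bar>" by linarith
  then have "L * 1 \<le> L * \<bar>real_of_int k\<bar>" using L_pos by (intro mult_left_mono) auto
  then show False using assms(2) L_pos by (simp add: r abs_mult)
qed

lemma open_off_lattice: "open {r. r / L \<notin> \<int>}"
proof -
  have "open ((\<lambda>r. r / L) -` (- \<int>))"
    using L_pos by (intro open_vimage) (auto intro!: closed_Ints continuous_intros simp: open_Compl)
  then show ?thesis by (simp add: vimage_def)
qed

text \<open>The term \<open>k = 0\<close> alone suffices, since
  \<open>\<bar>r\<bar> < L\<close>.\<close>

lemma pair_stiffness_ge: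
  assumes "0 < \<bar>r\<bar>" "\<bar>r\<bar> < L"
  shows "pair_stiffness r \<ge> L powr (- p)"
proof -
  have "L powr (- p) \<le> \<bar>r\<bar> powr (- p)"
    using assms p_gt by (intro powr_mono2') auto
  also have "\<dots> = (\<Sum>k\<in>{0 :: int}. 1 / \<bar>r + L * real_of_int k\<bar> powr p)"
    by (simp add: powr_minus_divide)
  also have "\<dots> \<le> pair_stiffness r"
    unfolding pair_stiffness_def
    by (rule finite_sum_le_infsum) (use stiffness_summable[OF off_lattice[OF assms]] in auto)
  finally show ?thesis .
qed

text \<open>The squared sine is even in \<open>r\<close> and has period \<open>L\<close>, so it
  depends only on the distance \<open>m\<close> to the lattice.\<close>

lemma sin_squared_bound:
  assumes "m = min \<bar>r\<bar> (L - \<bar>r\<bar>)" "0 < \<bar>r\<bar>" "\<bar>r\<bar> < L"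
  shows "(sin (pi * r / L))\<^sup>2 \<le> (pi * m / L)\<^sup>2"
proof -
  have "(sin (pi * r / L))\<^sup>2 = (sin (pi * \<bar>r\<bar> / L))\<^sup>2"
    by (cases "r \<ge> 0") auto
  also have "\<dots> = (sin (pi * m / L))\<^sup>2"
  proof (cases "\<bar>r\<bar> \<le> L - \<bar>r\<bar>")
    case False
    then have "m = L - \<bar>r\<bar>" using assms(1) by simp
    then have "pi * m / L = pi - pi * \<bar>r\<bar> / L"
      using L_pos by (simp add: right_diff_distrib diff_divide_distrib)
    then show ?thesis by simp
  qed (simp add: assms(1))
  also have "\<dots> \<le> (pi * m / L)\<^sup>2"
    unfolding abs_le_square_iff[symmetric] by (rule abs_sin_x_le_abs_x)
  finally show ?thesis .
qed

text \<open>The lattice terms are at least \<open>m / 2\<close> times the weights, which gives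
  \<open>2 powr p\<close>; the remaining power \<open>2 - p\<close> of \<open>m\<close> is positive,
  so \<open>m \<le> L\<close> finishes. Summed over \<open>\<Lambda>\<^sup>2\<close> pairs this has
  the order \<open>\<Lambda> powr (1 - 2 * s)\<close>.\<close>

lemma stiffness_times_chord_bound:
  assumes "0 < \<bar>r\<bar>" "\<bar>r\<bar> < L"
  shows "pair_stiffness r * (4 * (sin (pi * r / L))\<^sup>2) \<le> 4 * pi\<^sup>2 * 2 powr p * weight_sum * L powr (- p)"
proof -
  define m where "m = min \<bar>r\<bar> (L - \<bar>r\<bar>)"
  have m: "0 < m" "m \<le> L" using assms by (auto simp: m_def)
  have w: "weight_sum \<ge> 0" unfolding weight_sum_def by (rule infsum_nonneg) auto
  have "pair_stiffness r \<le> 1 / (m / 2) powr p * weight_sum"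
    using m assms by (intro stiffness_bounded_by_weight lattice_distance_ge) (auto simp: m_def)
  then have "pair_stiffness r * (4 * (sin (pi * r / L))\<^sup>2) \<le>
      (1 / (m / 2) powr p * weight_sum) * (4 * (pi * m / L)\<^sup>2)"
    using sin_squared_bound[OF m_def assms] w by (intro mult_mono) auto
  also have "\<dots> = 4 * pi\<^sup>2 * 2 powr p * weight_sum / L\<^sup>2 * (m\<^sup>2 / m powr p)"
    using m by (simp add: powr_divide power_mult_distrib power_divide mult_ac)
  also have "m\<^sup>2 / m powr p = m powr (2 - p)"
    using m by (simp add: powr_diff powr_numeral)
  also have "4 * pi\<^sup>2 * 2 powr p * weight_sum / L\<^sup>2 * m powr (2 - p) \<le>
      4 * pi\<^sup>2 * 2 powr p * weight_sum / L\<^sup>2 * L powr (2 - p)"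
    using m w p_lt by (intro mult_left_mono powr_mono2) auto
  also have "\<dots> = 4 * pi\<^sup>2 * 2 powr p * weight_sum * L powr (- p)"
    using L_pos by (simp add: powr_diff powr_minus_divide powr_numeral)
  finally show ?thesis .
qed

end

section \<open>The Hessian of the energy at regular configurations\<close>

lemma regular_config_distance:
  assumes "X \<in> regular_configs \<Lambda>" "a \<in> {1..\<Lambda>}" "b \<in> {1..\<Lambda>}" "a \<noteq> b"
  shows "0 < \<bar>X a - X b\<bar>" "\<bar>X a - X b\<bar> < real \<Lambda>"
proof -
  have "X a \<noteq> X b" using assms by (auto simp: regular_configs_def dest: inj_onD)
  moreover have "X a \<in> {0..<real \<Lambda>}" "X b \<in> {0..<real \<Lambda>}"
    using assms by (auto simp: regular_configs_def configs_def PiE_iff)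
  ultimately show "0 < \<bar>X a - X b\<bar>" "\<bar>X a - X b\<bar> < real \<Lambda>" by auto
qed

lemma pair_interaction_energy:
  assumes "0 < s" "s < 1 / 2" "\<Lambda> \<ge> 1"
  shows "pair_interaction \<Lambda> {r. r / real \<Lambda> \<notin> \<int>}
    (periodic_kernel.pair_energy (1 + 2 * s) (real \<Lambda>)) (periodic_kernel.pair_force (1 + 2 * s) (real \<Lambda>))
    (periodic_kernel.pair_stiffness (1 + 2 * s) (real \<Lambda>)) (energy s \<Lambda>)"
proof -
  interpret periodic_kernel "1 + 2 * s" "real \<Lambda>" by unfold_locales (use assms in auto)
  show ?thesis
  proof
    show "continuous_on {r. r / real \<Lambda> \<notin> \<int>} pair_stiffness"
      by (intro continuous_at_imp_continuous_on ballI isCont_pair_stiffness) auto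
  qed (auto intro: open_off_lattice pair_energy_DERIV pair_force_DERIV
      simp: energy_eq_pair_energy[OF assms] pair_sum_def)
qed

lemma regular_config_in_pair_domain:
  assumes "X \<in> regular_configs \<Lambda>"
  shows "X \<in> pair_domain \<Lambda> {r. r / real \<Lambda> \<notin> \<int>}"
proof (cases "\<Lambda> \<ge> 1")
  case True
  \<comment> \<open>Any exponent between 1 and 2 would do: \<open>off_lattice\<close> concerns only
    the period.\<close>
  interpret periodic_kernel "3 / 2" "real \<Lambda>" by unfold_locales (use True in auto)
  show ?thesis
    unfolding pair_domain_def
    by (intro CollectI ballI impI off_lattice regular_config_distance[OF assms])
qed (auto simp: pair_domain_def)

lemma energy_C2_near:
  assumes "0 < s" "s < 1 / 2" "\<Lambda> \<ge> 1" "X \<in> regular_configs \<Lambda>"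
  shows "C2_near \<Lambda> (energy s \<Lambda>) X"
  by (rule pair_interaction.C2_near_pair_domain[OF pair_interaction_energy[OF assms(1-3)]
      regular_config_in_pair_domain[OF assms(4)]])

lemma hessian_form_energy:
  assumes "0 < s" "s < 1 / 2" "\<Lambda> \<ge> 1" "X \<in> regular_configs \<Lambda>"
  shows "hessian_form \<Lambda> (energy s \<Lambda>) X h = (\<Sum>a = 1..\<Lambda>. \<Sum>b = 1..\<Lambda>.
    periodic_kernel.pair_stiffness (1 + 2 * s) (real \<Lambda>) (X a - X b) * (h a - h b)\<^sup>2)"
  by (rule pair_interaction.hessian_form_eq[OF pair_interaction_energy[OF assms(1-3)]
      regular_config_in_pair_domain[OF assms(4)]])

text \<open>Injectivity of \<open>X\<close> carries the sum over indices to positions, and symmetry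
  folds it onto unordered pairs.\<close>

lemma hessian_form_energy_coupling:
  assumes "0 < s" "s < 1 / 2" "\<Lambda> \<ge> 1" "X \<in> regular_configs \<Lambda>"
  shows "hessian_form \<Lambda> (energy s \<Lambda>) X h =
    (\<Sum>(\<xi>, \<eta>) \<in> {(\<xi>, \<eta>). \<xi> \<in> supp \<Lambda> X \<and> \<eta> \<in> supp \<Lambda> X \<and> \<xi> < \<eta>}.
       coupling s \<Lambda> \<xi> \<eta> * (h (index_of \<Lambda> X \<xi>) - h (index_of \<Lambda> X \<eta>))\<^sup>2)"
proof -
  interpret periodic_kernel "1 + 2 * s" "real \<Lambda>" by unfold_locales (use assms in auto)
  have inj: "inj_on X {1..\<Lambda>}" using assms by (simp add: regular_configs_def)
  let ?g = "\<lambda>\<xi> \<eta>. pair_stiffness (\<xi> - \<eta>) * (h (index_of \<Lambda> X \<xi>) - h (index_of \<Lambda> X \<eta>))\<^sup>2"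
  have "hessian_form \<Lambda> (energy s \<Lambda>) X h = (\<Sum>a = 1..\<Lambda>. \<Sum>b = 1..\<Lambda>. ?g (X a) (X b))"
    unfolding hessian_form_energy[OF assms] by (intro sum.cong refl) (simp add: index_of_eq[OF inj])
  also have "\<dots> = (\<Sum>\<xi>\<in>supp \<Lambda> X. \<Sum>\<eta>\<in>supp \<Lambda> X. ?g \<xi> \<eta>)"
    unfolding supp_def sum.reindex[OF inj] o_def ..
  also have "\<dots> = (\<Sum>(\<xi>, \<eta>)\<in>{(\<xi>, \<eta>). \<xi> \<in> supp \<Lambda> X \<and> \<eta> \<in> supp \<Lambda> X \<and> \<xi> < \<eta>}. 2 * ?g \<xi> \<eta>)"
  proof (rule sum_pairs_symmetric)
    show "?g \<xi> \<eta> = ?g \<eta> \<xi>" for \<xi> \<eta>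
      using pair_stiffness_minus[of "\<xi> - \<eta>"] by (simp add: power2_commute)
  qed (auto simp: supp_def)
  also have "\<dots> = (\<Sum>(\<xi>, \<eta>) \<in> {(\<xi>, \<eta>). \<xi> \<in> supp \<Lambda> X \<and> \<eta> \<in> supp \<Lambda> X \<and> \<xi> < \<eta>}.
       coupling s \<Lambda> \<xi> \<eta> * (h (index_of \<Lambda> X \<xi>) - h (index_of \<Lambda> X \<eta>))\<^sup>2)"
    by (simp add: coupling_def pair_stiffness_def mult.assoc)
  finally show ?thesis .
qed

text \<open>Replacing every stiffness by its minimum \<open>\<Lambda> powr (- (1 + 2 * s))\<close>
  leaves the sum of squared differences, equal to \<open>2 * \<Lambda>\<close> times the squared
  norm.\<close>

lemma hessian_form_energy_ge:
  assumes "0 < s" "s < 1 / 2" "\<Lambda> \<ge> 1" "X \<in> regular_configs \<Lambda>" and h: "(\<Sum>l = 1..\<Lambda>. h l) = 0"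
  shows "hessian_form \<Lambda> (energy s \<Lambda>) X h \<ge> 2 * real \<Lambda> powr (- 2 * s) * (\<Sum>l = 1..\<Lambda>. (h l)\<^sup>2)"
proof -
  interpret periodic_kernel "1 + 2 * s" "real \<Lambda>" by unfold_locales (use assms in auto)
  have "2 * real \<Lambda> powr (- 2 * s) * (\<Sum>l = 1..\<Lambda>. (h l)\<^sup>2) =
      real \<Lambda> powr (- (1 + 2 * s)) * (\<Sum>a = 1..\<Lambda>. \<Sum>b = 1..\<Lambda>. (h a - h b)\<^sup>2)"
  proof -
    have "real \<Lambda> powr (- 2 * s) = real \<Lambda> powr (- (1 + 2 * s)) * real \<Lambda>"
      using L_pos powr_add[of "real \<Lambda>" "- (1 + 2 * s)" 1] by simp
    then show ?thesis unfolding sum_square_differences h by simp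
  qed
  also have "\<dots> \<le> (\<Sum>a = 1..\<Lambda>. \<Sum>b = 1..\<Lambda>. pair_stiffness (X a - X b) * (h a - h b)\<^sup>2)"
    unfolding sum_distrib_left
  proof (intro sum_mono)
    fix a b assume ab: "a \<in> {1..\<Lambda>}" "b \<in> {1..\<Lambda>}"
    show "real \<Lambda> powr (- (1 + 2 * s)) * (h a - h b)\<^sup>2 \<le> pair_stiffness (X a - X b) * (h a - h b)\<^sup>2"
    proof (cases "a = b")
      case False
      then show ?thesis
        by (intro mult_right_mono pair_stiffness_ge regular_config_distance[OF assms(4) ab]) auto
    qed simp
  qed
  finally show ?thesis unfolding hessian_form_energy[OF assms(1-4)] .
qed

section \<open>Trial vectors for crystals\<close>

lemma crystal_sum_cis:
  assumes "\<Lambda> \<ge> 2" "X \<in> crystals \<Lambda>"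
  shows "(\<Sum>l = 1..\<Lambda>. cis (2 * pi * X l / real \<Lambda>)) = 0"
proof -
  obtain \<tau> where \<tau>: "supp \<Lambda> X = (\<lambda>j. real j + \<tau>) ` {..<\<Lambda>}" and inj: "inj_on X {1..\<Lambda>}"
    using assms(2) by (auto simp: crystals_def regular_configs_def)
  let ?w = "cis (2 * pi / real \<Lambda>)"
  have "(\<Sum>l = 1..\<Lambda>. cis (2 * pi * X l / real \<Lambda>)) = (\<Sum>\<xi>\<in>supp \<Lambda> X. cis (2 * pi * \<xi> / real \<Lambda>))"
    unfolding supp_def sum.reindex[OF inj] o_def ..
  also have "\<dots> = (\<Sum>j<\<Lambda>. cis (2 * pi * (real j + \<tau>) / real \<Lambda>))"
    unfolding \<tau> by (subst sum.reindex) (auto simp: inj_on_def)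
  also have "\<dots> = (\<Sum>j<\<Lambda>. cis (2 * pi * \<tau> / real \<Lambda>) * ?w ^ j)"
  proof (intro sum.cong refl)
    fix j
    have "2 * pi * (real j + \<tau>) / real \<Lambda> = 2 * pi * \<tau> / real \<Lambda> + real j * (2 * pi / real \<Lambda>)"
      by (simp add: add_divide_distrib algebra_simps)
    then show "cis (2 * pi * (real j + \<tau>) / real \<Lambda>) = cis (2 * pi * \<tau> / real \<Lambda>) * ?w ^ j"
      by (simp only: Complex.DeMoivre cis_mult)
  qed
  also have "\<dots> = cis (2 * pi * \<tau> / real \<Lambda>) * (\<Sum>j<\<Lambda>. ?w ^ j)"
    by (simp add: sum_distrib_left)
  \<comment> \<open>For \<open>\<Lambda> \<ge> 2\<close> the angle of \<open>?w\<close> lies in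
    \<open>(0, pi]\<close>, so the ratio is not 1 and the sum over all \<open>\<Lambda>\<close>-th
    roots of unity vanishes.\<close>
  also have "(\<Sum>j<\<Lambda>. ?w ^ j) = (?w ^ \<Lambda> - 1) / (?w - 1)"
  proof (rule geometric_sum)
    have "2 * pi / real \<Lambda> \<le> 2 * pi / 2" using assms(1) by (intro divide_left_mono) auto
    then have "cos (2 * pi / real \<Lambda>) < cos 0"
      using assms(1) by (intro cos_monotone_0_pi) auto
    then show "?w \<noteq> 1" by (auto simp: complex_eq_iff)
  qed
  also have "?w ^ \<Lambda> = 1" using assms(1) by (simp add: Complex.DeMoivre)
  finally show ?thesis by simp
qed

text \<open>The squared chord between two points of the unit circle: taken together, the two trial
  vectors see only differences of positions.\<close>

lemma cos_sin_chord:
  "(cos x - cos y)\<^sup>2 + (sin x - sin y)\<^sup>2 = 4 * (sin ((x - y) / 2))\<^sup>2" for x y :: real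
proof -
  have "(cos x - cos y)\<^sup>2 + (sin x - sin y)\<^sup>2 =
      ((cos x)\<^sup>2 + (sin x)\<^sup>2) + ((cos y)\<^sup>2 + (sin y)\<^sup>2) - 2 * (cos x * cos y + sin x * sin y)"
    by (simp add: power2_eq_square algebra_simps)
  also have "\<dots> = 2 - 2 * cos (2 * ((x - y) / 2))"
  proof -
    have "2 * ((x - y) / 2) = x - y" by simp
    then show ?thesis by (simp only: cos_diff) simp
  qed
  also have "\<dots> = 4 * (sin ((x - y) / 2))\<^sup>2" by (subst cos_double_sin) simp
  finally show ?thesis .
qed

text \<open>
  The forms of \<open>cos (2 \<pi> x / \<Lambda>)\<close> and \<open>sin (2 \<pi> x / \<Lambda>)\<close> are only estimated jointly: both bounds
  add up, so one of the two vectors satisfies the inequality.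
\<close>

lemma crystal_soft_mode:
  assumes s: "0 < s" "s < 1 / 2" and "\<Lambda> \<ge> 2" and X: "X \<in> crystals \<Lambda>"
    and K: "K = 4 * pi\<^sup>2 * 2 powr (1 + 2 * s) * periodic_kernel.weight_sum (1 + 2 * s)"
  shows "\<exists>h. (\<exists>l\<in>{1..\<Lambda>}. h l \<noteq> 0) \<and> (\<Sum>l = 1..\<Lambda>. h l) = 0 \<and>
    hessian_form \<Lambda> (energy s \<Lambda>) X h \<le> K * real \<Lambda> powr (- 2 * s) * (\<Sum>l = 1..\<Lambda>. (h l)\<^sup>2)"
proof -
  have \<Lambda>: "\<Lambda> \<ge> 1" using assms by simp
  interpret periodic_kernel "1 + 2 * s" "real \<Lambda>" by unfold_locales (use assms in auto)
  have reg: "X \<in> regular_configs \<Lambda>" using X by (simp add: crystals_def)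
  define c where "c l = cos (2 * pi * X l / real \<Lambda>)" for l
  define d where "d l = sin (2 * pi * X l / real \<Lambda>)" for l
  let ?Q = "hessian_form \<Lambda> (energy s \<Lambda>) X"
  let ?k = "K * real \<Lambda> powr (- 2 * s)"
  let ?n = "\<lambda>h :: nat \<Rightarrow> real. \<Sum>l = 1..\<Lambda>. (h l)\<^sup>2"
  have sums: "(\<Sum>l = 1..\<Lambda>. c l) = 0" "(\<Sum>l = 1..\<Lambda>. d l) = 0"
    using crystal_sum_cis[OF assms(3) X] by (auto simp: complex_eq_iff c_def d_def)
  have K0: "K \<ge> 0"
    unfolding K weight_sum_def by (intro mult_nonneg_nonneg infsum_nonneg) auto
  have "?Q c + ?Q d = (\<Sum>a = 1..\<Lambda>. \<Sum>b = 1..\<Lambda>.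
      pair_stiffness (X a - X b) * (4 * (sin (pi * (X a - X b) / real \<Lambda>))\<^sup>2))"
  proof -
    have "(c a - c b)\<^sup>2 + (d a - d b)\<^sup>2 = 4 * (sin (pi * (X a - X b) / real \<Lambda>))\<^sup>2" for a b
      unfolding c_def d_def cos_sin_chord by (simp add: diff_divide_distrib algebra_simps)
    then show ?thesis
      unfolding hessian_form_energy[OF s \<Lambda> reg] sum.distrib[symmetric] distrib_left[symmetric] by simp
  qed
  also have "\<dots> \<le> (\<Sum>a = 1..\<Lambda>. \<Sum>b = 1..\<Lambda>. K * real \<Lambda> powr (- (1 + 2 * s)))"
  proof (intro sum_mono)
    fix a b assume "a \<in> {1..\<Lambda>}" "b \<in> {1..\<Lambda>}"
    \<comment> \<open>On the diagonal the left side is 0, and \<open>K0\<close> is what is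
      used.\<close>
    then show "pair_stiffness (X a - X b) * (4 * (sin (pi * (X a - X b) / real \<Lambda>))\<^sup>2)
        \<le> K * real \<Lambda> powr (- (1 + 2 * s))"
      using stiffness_times_chord_bound[of "X a - X b"] regular_config_distance[OF reg, of a b] K0
      unfolding K by (cases "a = b") auto
  qed
  also have "\<dots> = ?k * real \<Lambda>"
  proof -
    have "real \<Lambda> powr (- 2 * s) = real \<Lambda> powr (- (1 + 2 * s)) * real \<Lambda>"
      using L_pos powr_add[of "real \<Lambda>" "- (1 + 2 * s)" 1] by simp
    then show ?thesis by simp
  qed
  finally have Q: "?Q c + ?Q d \<le> ?k * real \<Lambda>" .
  have norm: "?n c + ?n d = real \<Lambda>"
    unfolding sum.distrib[symmetric] by (simp add: c_def d_def)
  have Q': "?Q c + ?Q d \<le> ?k * ?n c + ?k * ?n d"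
    unfolding distrib_left[symmetric] norm by (rule Q)
  \<comment> \<open>Prevents the choice of a vanishing vector: if one of the two vanishes, the other
    carries the whole norm and satisfies the inequality alone.\<close>
  have zero: "?Q h = 0 \<and> ?n h = 0" if "\<not> (\<exists>l\<in>{1..\<Lambda>}. h l \<noteq> 0)" for h
    using that unfolding hessian_form_energy[OF s \<Lambda> reg] by simp
  have "?n c + ?n d > 0" unfolding norm by (rule L_pos)
  then have "(\<exists>l\<in>{1..\<Lambda>}. c l \<noteq> 0) \<and> ?Q c \<le> ?k * ?n c \<or> (\<exists>l\<in>{1..\<Lambda>}. d l \<noteq> 0) \<and> ?Q d \<le> ?k * ?n d"
  proof (cases "(\<exists>l\<in>{1..\<Lambda>}. c l \<noteq> 0) \<and> ?Q c \<le> ?k * ?n c")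
    case False
    have "?Q d \<le> ?k * ?n d"
    proof (cases "\<exists>l\<in>{1..\<Lambda>}. c l \<noteq> 0")
      case True
      with False Q' show ?thesis by linarith
    qed (use zero[of c] Q' in simp)
    moreover have "\<exists>l\<in>{1..\<Lambda>}. d l \<noteq> 0"
    proof (rule ccontr)
      assume "\<not> (\<exists>l\<in>{1..\<Lambda>}. d l \<noteq> 0)"
      then have d0: "?Q d = 0" "?n d = 0" using zero by blast+
      then have "?Q c \<le> ?k * ?n c" using Q' by simp
      with False have "?n c = 0" using zero by blast
      with d0 \<open>?n c + ?n d > 0\<close> show False by simp
    qed
    ultimately show ?thesis by blast
  qed blast
  then show ?thesis using sums by blast
qed

text \<open>For \<open>\<Lambda> = 1\<close> the condition of sum zero forces \<open>h = 0\<close>,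
  so the last part starts at \<open>\<Lambda> = 2\<close>. Unordered pairs are encoded by
  \<open>\<xi> < \<eta>\<close>, and \<open>C2_near\<close> guarantees that the Hessian is a genuine
  one.\<close>

theorem proposition2p2:
  fixes s :: real
  assumes "0 < s" and "s < 1 / 2"
  shows
    "(\<forall>\<Lambda>\<ge>1. \<forall>X\<in>regular_configs \<Lambda>. supp \<Lambda> X \<subseteq> {0<..<real \<Lambda>} \<longrightarrow>
        C2_near \<Lambda> (energy s \<Lambda>) X \<and>
        (\<forall>h :: nat \<Rightarrow> real. hessian_form \<Lambda> (energy s \<Lambda>) X h =
          (\<Sum>(\<xi>, \<eta>) \<in> {(\<xi>, \<eta>). \<xi> \<in> supp \<Lambda> X \<and> \<eta> \<in> supp \<Lambda> X \<and> \<xi> < \<eta>}.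
             coupling s \<Lambda> \<xi> \<eta> * (h (index_of \<Lambda> X \<xi>) - h (index_of \<Lambda> X \<eta>))\<^sup>2))) \<and>
     (\<exists>\<gamma>>0. \<forall>\<Lambda>\<ge>1. \<forall>X\<in>regular_configs \<Lambda>. supp \<Lambda> X \<subseteq> {0<..<real \<Lambda>} \<longrightarrow>
        (\<forall>h :: nat \<Rightarrow> real. (\<Sum>l = 1..\<Lambda>. h l) = 0 \<longrightarrow>
          hessian_form \<Lambda> (energy s \<Lambda>) X h \<ge> \<gamma> * real \<Lambda> powr (- 2 * s) * (\<Sum>l = 1..\<Lambda>. (h l)\<^sup>2))) \<and>
     (\<exists>\<Gamma>>0. \<forall>\<Lambda>\<ge>2. \<forall>X\<in>crystals \<Lambda>.
        C2_near \<Lambda> (energy s \<Lambda>) X \<and>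
        (\<exists>h :: nat \<Rightarrow> real. (\<exists>l\<in>{1..\<Lambda>}. h l \<noteq> 0) \<and> (\<Sum>l = 1..\<Lambda>. h l) = 0 \<and>
          hessian_form \<Lambda> (energy s \<Lambda>) X h \<le> \<Gamma> * real \<Lambda> powr (- 2 * s) * (\<Sum>l = 1..\<Lambda>. (h l)\<^sup>2)))"
proof (intro conjI)
  show "\<forall>\<Lambda>\<ge>1. \<forall>X\<in>regular_configs \<Lambda>. supp \<Lambda> X \<subseteq> {0<..<real \<Lambda>} \<longrightarrow>
        C2_near \<Lambda> (energy s \<Lambda>) X \<and>
        (\<forall>h :: nat \<Rightarrow> real. hessian_form \<Lambda> (energy s \<Lambda>) X h =
          (\<Sum>(\<xi>, \<eta>) \<in> {(\<xi>, \<eta>). \<xi> \<in> supp \<Lambda> X \<and> \<eta> \<in> supp \<Lambda> X \<and> \<xi> < \<eta>}.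
             coupling s \<Lambda> \<xi> \<eta> * (h (index_of \<Lambda> X \<xi>) - h (index_of \<Lambda> X \<eta>))\<^sup>2))"
    using energy_C2_near[OF assms] hessian_form_energy_coupling[OF assms] by blast
  show "\<exists>\<gamma>>0. \<forall>\<Lambda>\<ge>1. \<forall>X\<in>regular_configs \<Lambda>. supp \<Lambda> X \<subseteq> {0<..<real \<Lambda>} \<longrightarrow>
        (\<forall>h :: nat \<Rightarrow> real. (\<Sum>l = 1..\<Lambda>. h l) = 0 \<longrightarrow>
          hessian_form \<Lambda> (energy s \<Lambda>) X h \<ge> \<gamma> * real \<Lambda> powr (- 2 * s) * (\<Sum>l = 1..\<Lambda>. (h l)\<^sup>2))"
    using hessian_form_energy_ge[OF assms] by (intro exI[of _ 2]) auto
  define K where "K = 4 * pi\<^sup>2 * 2 powr (1 + 2 * s) * periodic_kernel.weight_sum (1 + 2 * s)"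
  have "K \<ge> 0"
  proof -
    \<comment> \<open>The period 1 is a placeholder, as \<open>weight_sum\<close> depends on the
      exponent only.\<close>
    interpret periodic_kernel "1 + 2 * s" 1 by unfold_locales (use assms in auto)
    show ?thesis unfolding K_def weight_sum_def by (intro mult_nonneg_nonneg infsum_nonneg) auto
  qed
  show "\<exists>\<Gamma>>0. \<forall>\<Lambda>\<ge>2. \<forall>X\<in>crystals \<Lambda>.
        C2_near \<Lambda> (energy s \<Lambda>) X \<and>
        (\<exists>h :: nat \<Rightarrow> real. (\<exists>l\<in>{1..\<Lambda>}. h l \<noteq> 0) \<and> (\<Sum>l = 1..\<Lambda>. h l) = 0 \<and>
          hessian_form \<Lambda> (energy s \<Lambda>) X h \<le> \<Gamma> * real \<Lambda> powr (- 2 * s) * (\<Sum>l = 1..\<Lambda>. (h l)\<^sup>2))"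
  \<comment> \<open>Only \<open>K \<ge> 0\<close> has been shown; adding 1 makes the constant
    positive.\<close>
  proof (intro exI[of _ "K + 1"] conjI allI impI ballI)
    show "0 < K + 1" using \<open>K \<ge> 0\<close> by simp
    fix \<Lambda> :: nat and X assume \<Lambda>: "2 \<le> \<Lambda>" and X: "X \<in> crystals \<Lambda>"
    show "C2_near \<Lambda> (energy s \<Lambda>) X"
      using energy_C2_near[OF assms, of \<Lambda> X] \<Lambda> X by (simp add: crystals_def)
    obtain h :: "nat \<Rightarrow> real" where h: "\<exists>l\<in>{1..\<Lambda>}. h l \<noteq> 0" "(\<Sum>l = 1..\<Lambda>. h l) = 0"
      "hessian_form \<Lambda> (energy s \<Lambda>) X h \<le> K * real \<Lambda> powr (- 2 * s) * (\<Sum>l = 1..\<Lambda>. (h l)\<^sup>2)"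
      using crystal_soft_mode[OF assms \<Lambda> X K_def] by blast
    have "K * real \<Lambda> powr (- 2 * s) * (\<Sum>l = 1..\<Lambda>. (h l)\<^sup>2) \<le>
        (K + 1) * real \<Lambda> powr (- 2 * s) * (\<Sum>l = 1..\<Lambda>. (h l)\<^sup>2)"
      by (intro mult_right_mono sum_nonneg) auto
    with h show "\<exists>h :: nat \<Rightarrow> real. (\<exists>l\<in>{1..\<Lambda>}. h l \<noteq> 0) \<and> (\<Sum>l = 1..\<Lambda>. h l) = 0 \<and>
          hessian_form \<Lambda> (energy s \<Lambda>) X h \<le> (K + 1) * real \<Lambda> powr (- 2 * s) * (\<Sum>l = 1..\<Lambda>. (h l)\<^sup>2)"
      by (meson order_trans)
  qed
qed

end
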